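(* 1. Let $(c,d)\in\mathcal S$ and let $I^*=(I^{*,+},I^{*,-})\in\mathcal I$ be an optimal control, i.e. $v(c,d)=G(c,d;I^* )$. Define the stopping times $$\sigma^*:=\inf\{t\ge0: I^{*,-}_t>0\},\qquad\tau^*:=\inf\{t\ge0: I^{*,+}_t>0\}.$$ Then $(\sigma^*,\tau^* )\in\mathcal T\times\mathcal T$ is a saddle point for the associated Dynkin game, i.e. $$J(c,d;\sigma^*,\tau)\le J(c,d;\sigma^*,\tau^* )\le J(c,d;\sigma,\tau^* )\qquad\forall\sigma\in\mathcal T,\ \forall\tau\in\mathcal T.$$ 2. $v$ is differentiable with respect to $c$ in $\mathcal S$ and $v_c=w$ on $\mathcal S$, where $w$ is the (well-defined) value of the associated Dynkin game.
   Context: Setting. $(\Omega,\mathcal F,\mathbb P)$ is a probability space with a filtration $\mathbb F=(\mathcal F_t)_{t\ge 0}$ satisfying the usual conditions and supporting a standard one-dimensional Brownian motion $W$. Let $\mathcal O=(d_{\min},d_{\max})$ with $-\infty\le d_{\min}<d_{\max}\le\infty$ and $\mathcal S=\mathbb R\times\mathcal O$. Demand: $\mathrm dD_t=\mu(D_t)\mathrm dt+\boldsymbol\sigma(D_t)\mathrm dW_t$, $D_0=d$ (diffusion coefficient written $\boldsymbol\sigma$ to distinguish it from the stopping time $\sigma$), where $\mu,\boldsymbol\sigma:\mathcal O\to\mathbb R$ are continuous with at most linear growth; for every $d\in\mathcal O$ there is a unique non-exploding continuous solution $D^d$ with values in $\mathcal O$; if $d_n\to d$ in $\mathcal O$ then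 $D^{d_n}_t\to D^d_t$ a.s. for every $t$; if $d\le d'$ then $D^d_t\le D^{d'}_t$ a.s. for every $t\ge0$; $D$ is a regular diffusion and $d_{\min},d_{\max}$ are natural boundaries (Feller's classification). Cost: $g:\mathcal S\to[0,\infty)$ is continuous, $g(\cdot,d)\in C^1(\mathbb R)$ is convex for every $d$, the partial derivative $g_c$ is continuous on $\mathcal S$, $g_c(c,\cdot)$ is nonincreasing for every $c$, and $|g(c,d)|+|g_c(c,d)|\le\gamma_0(c)+\eta_0(c)|d|^\nu$ for some positive locally bounded $\gamma_0,\eta_0$ and some $\nu\ge0$. $K_0\ge0,K_1\in\mathbb R$ are constants such that $\mathbb E|D^d_t|^\nu\le K_0(1+|d|^\nu)e^{K_1t}$ for all $t,d$ (they exist by linear growth), and $\rho>\max(K_1,0)$. The constants $q_0^+,q_0^-$ are in $(0,\infty)$. Controls: $\mathcal I$ is the set of càdlàg $\mathbb F$-adapted processes $I$ of bounded variation on bounded time intervals, with $I_{0^-}=0$; $I=I^+-I^-$ is the minimal decomposition ($I^\pm$ the positive/negative variations), also written $I=(I^+,I^-)$. Capacity: $C^{c,I}_t=c+I_t$. Define $$G(c,d;I)=\mathbb E\Big[\int_0^\infty e^{-\rho t}\big(g(C^{c,I}_t,D^d_t)\mathrm dt+q_0^+\mathrm dI^+_t+q_0^-\mathrm dI^-_t\big)\Big]$$ (a jump at time $0$ is counted), and $v(c,d)=\inf_{I\in\mathcal I}G(c,d;I)$. It is known that an optimal control exists for every $(c,d)\in\mathcal S$. Associated Dynkin game: $\mathcal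 T$ is the set of all $\mathbb F$-stopping times (with values in $[0,\infty]$); for $\sigma,\tau\in\mathcal T$, $$J(c,d;\sigma,\tau)=\mathbb E\Big[\int_0^{\sigma\wedge\tau}e^{-\rho t}g_c(c,D^d_t)\mathrm dt+q_0^-e^{-\rho\sigma}\mathbf 1_{\{\sigma<\tau\}}-q_0^+e^{-\rho\tau}\mathbf 1_{\{\tau<\sigma\}}\Big].$$ The game has a value $w(c,d)$ if $\sup_{\tau\in\mathcal T}\inf_{\sigma\in\mathcal T}J(c,d;\sigma,\tau)=\inf_{\sigma\in\mathcal T}\sup_{\tau\in\mathcal T}J(c,d;\sigma,\tau)=:w(c,d)$. Convention $\inf\emptyset=\infty$. *)

theory Defs
  imports "HOL-Probability.Probability"
begin

section \<open>Filtrations and Brownian motion\<close>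

text \<open>
  Filtrations are indexed by \<^typ>\<open>ennreal\<close>, so that the library's \<^const>\<open>stopping_time\<close> is the
  notion of a stopping time with values in \<open>[0,\<infinity>]\<close>: its condition at \<open>t = \<infinity>\<close> is vacuous. Processes
  are functions of a real time, of which only the values at \<open>t \<ge> 0\<close> are relevant.
\<close>

definition usual_conditions :: "'a measure \<Rightarrow> (ennreal \<Rightarrow> 'a measure) \<Rightarrow> bool" where
  "usual_conditions M F \<longleftrightarrow>
     (\<forall>N\<in>null_sets M. \<forall>A. A \<subseteq> N \<longrightarrow> A \<in> sets (F 0)) \<and>
     (\<forall>t<\<infinity>. sets (F t) = (\<Inter>u\<in>{t<..}. sets (F u)))"

definition adapted :: "(ennreal \<Rightarrow> 'a measure) \<Rightarrow> (real \<Rightarrow> 'a \<Rightarrow> real) \<Rightarrow> bool" where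
  "adapted F X \<longleftrightarrow> (\<forall>t\<ge>0. X t \<in> borel_measurable (F (ennreal t)))"

definition brownian_motion ::
  "'a measure \<Rightarrow> (ennreal \<Rightarrow> 'a measure) \<Rightarrow> (real \<Rightarrow> 'a \<Rightarrow> real) \<Rightarrow> bool" where
  "brownian_motion M F W \<longleftrightarrow>
     adapted F W \<and>
     (AE \<omega> in M. W 0 \<omega> = 0) \<and>
     (AE \<omega> in M. continuous_on {0..} (\<lambda>t. W t \<omega>)) \<and>
     (\<forall>s\<ge>0. \<forall>t>s.
        distributed M lborel (\<lambda>\<omega>. W t \<omega> - W s \<omega>) (normal_density 0 (sqrt (t - s))) \<and>
        prob_space.indep_set M (sets (F (ennreal s)))
          {(\<lambda>\<omega>. W t \<omega> - W s \<omega>) -` B \<inter> space M | B. B \<in> sets borel})"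

section \<open>The Ito integral and the stochastic differential equation\<close>

definition conv_in_prob :: "'a measure \<Rightarrow> (nat \<Rightarrow> 'a \<Rightarrow> real) \<Rightarrow> ('a \<Rightarrow> real) \<Rightarrow> bool" where
  "conv_in_prob M X Z \<longleftrightarrow>
     (\<forall>\<epsilon>>0. (\<lambda>n. measure M {\<omega>\<in>space M. \<bar>X n \<omega> - Z \<omega>\<bar> > \<epsilon>}) \<longlonglongrightarrow> 0)"

definition progressively_measurable ::
  "(ennreal \<Rightarrow> 'a measure) \<Rightarrow> (real \<Rightarrow> 'a \<Rightarrow> real) \<Rightarrow> bool" where
  "progressively_measurable F H \<longleftrightarrow>
     (\<forall>t\<ge>0. (\<lambda>(s, \<omega>). H s \<omega>) \<in>
        borel_measurable (restrict_space borel {0..t} \<Otimes>\<^sub>M F (ennreal t)))"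

text \<open>
  A triple \<open>(n, p, \<xi>)\<close> encodes the simple process that equals \<open>\<xi> i\<close> on \<open>(p i, p (i + 1)]\<close>, \<open>i < n\<close>.
\<close>

type_synonym 'a simple_process = "nat \<times> (nat \<Rightarrow> real) \<times> (nat \<Rightarrow> 'a \<Rightarrow> real)"

definition is_simple_process :: "(ennreal \<Rightarrow> 'a measure) \<Rightarrow> 'a simple_process \<Rightarrow> bool" where
  "is_simple_process F = (\<lambda>(n, p, \<xi>).
     p 0 = 0 \<and> (\<forall>i<n. p i \<le> p (Suc i)) \<and>
     (\<forall>i<n. \<xi> i \<in> borel_measurable (F (ennreal (p i))) \<and>
            (\<exists>B. \<forall>\<omega>\<in>space (F (ennreal (p i))). \<bar>\<xi> i \<omega>\<bar> \<le> B)))"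

definition simple_process :: "'a simple_process \<Rightarrow> real \<Rightarrow> 'a \<Rightarrow> real" where
  "simple_process = (\<lambda>(n, p, \<xi>) s \<omega>. \<Sum>i<n. \<xi> i \<omega> * indicator {p i<..p (Suc i)} s)"

definition simple_integral ::
  "(real \<Rightarrow> 'a \<Rightarrow> real) \<Rightarrow> 'a simple_process \<Rightarrow> real \<Rightarrow> 'a \<Rightarrow> real" where
  "simple_integral W = (\<lambda>(n, p, \<xi>) t \<omega>.
     \<Sum>i<n. \<xi> i \<omega> * (W (min t (p (Suc i))) \<omega> - W (min t (p i)) \<omega>))"

text \<open>
  \<open>is_ito_integral M F W H t Z\<close> says that \<open>Z\<close> is (a version of) the Ito integral
  \<open>\<integral>\<^sub>0\<^sup>t H\<^sub>s dW\<^sub>s\<close> of a progressively measurable integrand with \<open>\<integral>\<^sub>0\<^sup>t H\<^sub>s\<^sup>2 ds < \<infinity>\<close> almost surely.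
\<close>

definition is_ito_integral ::
  "'a measure \<Rightarrow> (ennreal \<Rightarrow> 'a measure) \<Rightarrow> (real \<Rightarrow> 'a \<Rightarrow> real) \<Rightarrow>
   (real \<Rightarrow> 'a \<Rightarrow> real) \<Rightarrow> real \<Rightarrow> ('a \<Rightarrow> real) \<Rightarrow> bool" where
  "is_ito_integral M F W H t Z \<longleftrightarrow>
     progressively_measurable F H \<and>
     (AE \<omega> in M. (\<integral>\<^sup>+s\<in>{0..t}. ennreal ((H s \<omega>)\<^sup>2) \<partial>lborel) < \<infinity>) \<and>
     Z \<in> borel_measurable M \<and>
     (\<exists>S :: nat \<Rightarrow> 'a simple_process.
        (\<forall>n. is_simple_process F (S n)) \<and>
        (\<forall>\<epsilon>>0. (\<lambda>n. measure M {\<omega>\<in>space M.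
           (\<integral>\<^sup>+s\<in>{0..t}. ennreal ((simple_process (S n) s \<omega> - H s \<omega>)\<^sup>2) \<partial>lborel) > ennreal \<epsilon>})
           \<longlonglongrightarrow> 0) \<and>
        conv_in_prob M (\<lambda>n. simple_integral W (S n) t) Z)"

definition sde_solution ::
  "'a measure \<Rightarrow> (ennreal \<Rightarrow> 'a measure) \<Rightarrow> (real \<Rightarrow> 'a \<Rightarrow> real) \<Rightarrow> real set \<Rightarrow>
   (real \<Rightarrow> real) \<Rightarrow> (real \<Rightarrow> real) \<Rightarrow> real \<Rightarrow> (real \<Rightarrow> 'a \<Rightarrow> real) \<Rightarrow> bool" where
  "sde_solution M F W Dom \<mu> \<Sigma> d X \<longleftrightarrow>
     adapted F X \<and>
     (\<forall>\<omega>\<in>space M. continuous_on {0..} (\<lambda>t. X t \<omega>)) \<and>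
     (\<forall>\<omega>\<in>space M. \<forall>t\<ge>0. X t \<omega> \<in> Dom) \<and>
     (AE \<omega> in M. X 0 \<omega> = d) \<and>
     (\<forall>t\<ge>0. is_ito_integral M F W (\<lambda>s \<omega>. \<Sigma> (X s \<omega>)) t
        (\<lambda>\<omega>. X t \<omega> - d - (LINT s:{0..t}|lborel. \<mu> (X s \<omega>))))"

section \<open>Regular diffusions and Feller's natural boundaries\<close>

definition open_interval :: "ereal \<Rightarrow> ereal \<Rightarrow> real set" where
  "open_interval l r = {x. l < ereal x \<and> ereal x < r}"

definition hitting_time :: "(real \<Rightarrow> 'a \<Rightarrow> real) \<Rightarrow> real \<Rightarrow> 'a \<Rightarrow> ennreal" where
  "hitting_time X y \<omega> = Inf {ennreal t | t. 0 \<le> t \<and> X t \<omega> = y}"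

text \<open>Below, \<open>D x\<close> is the diffusion started at \<open>x\<close>.\<close>

definition regular_diffusion ::
  "'a measure \<Rightarrow> real set \<Rightarrow> (real \<Rightarrow> real \<Rightarrow> 'a \<Rightarrow> real) \<Rightarrow> bool" where
  "regular_diffusion M Dom D \<longleftrightarrow>
     (\<forall>x\<in>Dom. \<forall>y\<in>Dom. measure M {\<omega>\<in>space M. hitting_time (D x) y \<omega> < \<infinity>} > 0)"

definition scale_function ::
  "'a measure \<Rightarrow> real set \<Rightarrow> (real \<Rightarrow> real \<Rightarrow> 'a \<Rightarrow> real) \<Rightarrow> (real \<Rightarrow> real) \<Rightarrow> bool" where
  "scale_function M Dom D s \<longleftrightarrow>
     continuous_on Dom s \<and> strict_mono_on Dom s \<and>
     (\<forall>a\<in>Dom. \<forall>b\<in>Dom. \<forall>x\<in>{a<..<b}.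
        measure M {\<omega>\<in>space M. hitting_time (D x) b \<omega> < hitting_time (D x) a \<omega>}
          = (s x - s a) / (s b - s a))"

text \<open>
  The speed measure is characterised through the mean exit times from \<open>(a,b)\<close>, expressed with the
  Green function of the diffusion killed on leaving \<open>(a,b)\<close>. For an equation with smooth scale
  function this normalisation gives \<open>2 / (\<Sigma>(y)\<^sup>2 s'(y)) dy\<close>.
\<close>

definition speed_measure ::
  "'a measure \<Rightarrow> real set \<Rightarrow> (real \<Rightarrow> real \<Rightarrow> 'a \<Rightarrow> real) \<Rightarrow> (real \<Rightarrow> real) \<Rightarrow> real measure \<Rightarrow> bool"
  where
  "speed_measure M Dom D s m \<longleftrightarrow>
     sets m = sets borel \<and>
     (\<forall>a\<in>Dom. \<forall>b\<in>Dom. \<forall>x\<in>{a<..<b}.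
        (\<integral>\<^sup>+\<omega>. min (hitting_time (D x) a \<omega>) (hitting_time (D x) b \<omega>) \<partial>M)
          = (\<integral>\<^sup>+y\<in>{a<..<b}.
               ennreal ((s (min x y) - s a) * (s b - s (max x y)) / (s b - s a)) \<partial>m))"

text \<open>
  An end point is natural if it is neither an exit nor an entrance boundary. For the left end point
  \<open>l\<close> the two Feller integrals over \<open>(l,z)\<close> have the integrands \<open>s(y) - s(l+)\<close> (finite integral iff
  \<open>l\<close> is attainable) and \<open>s(z) - s(y)\<close> (finite integral iff the diffusion can be started at \<open>l\<close>)
  with respect to \<open>m(dy)\<close>; the right end point is symmetric. The suprema below are \<open>s(y) - s(l+)\<close>
  and \<open>s(r-) - s(y)\<close>, possibly infinite.
\<close>

definition natural_left :: "real set \<Rightarrow> (real \<Rightarrow> real) \<Rightarrow> real measure \<Rightarrow> bool" where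
  "natural_left Dom s m \<longleftrightarrow> (\<forall>z\<in>Dom.
     (\<integral>\<^sup>+y\<in>Dom \<inter> {..<z}. (SUP a\<in>Dom. ennreal (s y - s a)) \<partial>m) = \<infinity> \<and>
     (\<integral>\<^sup>+y\<in>Dom \<inter> {..<z}. ennreal (s z - s y) \<partial>m) = \<infinity>)"

definition natural_right :: "real set \<Rightarrow> (real \<Rightarrow> real) \<Rightarrow> real measure \<Rightarrow> bool" where
  "natural_right Dom s m \<longleftrightarrow> (\<forall>z\<in>Dom.
     (\<integral>\<^sup>+y\<in>Dom \<inter> {z<..}. (SUP b\<in>Dom. ennreal (s b - s y)) \<partial>m) = \<infinity> \<and>
     (\<integral>\<^sup>+y\<in>Dom \<inter> {z<..}. ennreal (s y - s z) \<partial>m) = \<infinity>)"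

definition natural_boundaries ::
  "'a measure \<Rightarrow> real set \<Rightarrow> (real \<Rightarrow> real \<Rightarrow> 'a \<Rightarrow> real) \<Rightarrow> bool" where
  "natural_boundaries M Dom D \<longleftrightarrow>
     (\<exists>s m. scale_function M Dom D s \<and> speed_measure M Dom D s m \<and>
            natural_left Dom s m \<and> natural_right Dom s m)"

section \<open>The control problem\<close>

text \<open>Extension by \<open>0\<close> to negative times, encoding \<open>f(0-) = 0\<close>.\<close>

definition ext0 :: "(real \<Rightarrow> real) \<Rightarrow> real \<Rightarrow> real" where
  "ext0 f t = (if t < 0 then 0 else f t)"

definition partitions_upto :: "real \<Rightarrow> (nat \<times> (nat \<Rightarrow> real)) set" where
  "partitions_upto t = {(n, p). (\<forall>i<n. p i \<le> p (Suc i)) \<and> p n \<le> t}"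

definition bounded_variation_upto :: "(real \<Rightarrow> real) \<Rightarrow> real \<Rightarrow> bool" where
  "bounded_variation_upto f t \<longleftrightarrow>
     bdd_above ((\<lambda>(n, p). \<Sum>i<n. \<bar>ext0 f (p (Suc i)) - ext0 f (p i)\<bar>) ` partitions_upto t)"

text \<open>
  Positive and negative variation on \<open>[0-, t]\<close>; partition points may be negative, so a jump at time
  \<open>0\<close> is included.
\<close>

definition pos_variation :: "(real \<Rightarrow> real) \<Rightarrow> real \<Rightarrow> real" where
  "pos_variation f t =
     (SUP (n, p)\<in>partitions_upto t. \<Sum>i<n. max 0 (ext0 f (p (Suc i)) - ext0 f (p i)))"

definition neg_variation :: "(real \<Rightarrow> real) \<Rightarrow> real \<Rightarrow> real" where
  "neg_variation f t =
     (SUP (n, p)\<in>partitions_upto t. \<Sum>i<n. max 0 (ext0 f (p i) - ext0 f (p (Suc i))))"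

definition cadlag :: "(real \<Rightarrow> real) \<Rightarrow> bool" where
  "cadlag f \<longleftrightarrow>
     (\<forall>t\<ge>0. continuous (at_right t) f) \<and> (\<forall>t>0. \<exists>l. (f \<longlongrightarrow> l) (at_left t))"

definition controls ::
  "'a measure \<Rightarrow> (ennreal \<Rightarrow> 'a measure) \<Rightarrow> (real \<Rightarrow> 'a \<Rightarrow> real) set" where
  "controls M F = {I. adapted F I \<and>
     (\<forall>\<omega>\<in>space M. cadlag (\<lambda>t. I t \<omega>) \<and> (\<forall>T\<ge>0. bounded_variation_upto (\<lambda>t. I t \<omega>) T))}"

text \<open>In the following two definitions \<open>X\<close> is the demand process \<open>D\<^sup>d\<close>.\<close>

definition total_cost ::
  "'a measure \<Rightarrow> real \<Rightarrow> real \<Rightarrow> real \<Rightarrow> (real \<Rightarrow> real \<Rightarrow> real) \<Rightarrow> (real \<Rightarrow> 'a \<Rightarrow> real) \<Rightarrow>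
   real \<Rightarrow> (real \<Rightarrow> 'a \<Rightarrow> real) \<Rightarrow> ennreal" where
  "total_cost M \<rho> qp qm g X c I =
     (\<integral>\<^sup>+\<omega>.
        (\<integral>\<^sup>+t\<in>{0..}. ennreal (exp (- \<rho> * t) * g (c + I t \<omega>) (X t \<omega>)) \<partial>lborel)
        + ennreal qp * (\<integral>\<^sup>+t\<in>{0..}. ennreal (exp (- \<rho> * t))
            \<partial>interval_measure (ext0 (pos_variation (\<lambda>t. I t \<omega>))))
        + ennreal qm * (\<integral>\<^sup>+t\<in>{0..}. ennreal (exp (- \<rho> * t))
            \<partial>interval_measure (ext0 (neg_variation (\<lambda>t. I t \<omega>)))) \<partial>M)"

definition value_fun ::
  "'a measure \<Rightarrow> (ennreal \<Rightarrow> 'a measure) \<Rightarrow> real \<Rightarrow> real \<Rightarrow> real \<Rightarrow> (real \<Rightarrow> real \<Rightarrow> real) \<Rightarrow>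
   (real \<Rightarrow> real \<Rightarrow> 'a \<Rightarrow> real) \<Rightarrow> real \<Rightarrow> real \<Rightarrow> ennreal" where
  "value_fun M F \<rho> qp qm g D c d = (INF I\<in>controls M F. total_cost M \<rho> qp qm g (D d) c I)"

section \<open>The associated Dynkin game\<close>

definition discount :: "real \<Rightarrow> ennreal \<Rightarrow> real" where
  "discount \<rho> s = (if s = \<infinity> then 0 else exp (- \<rho> * enn2real s))"

definition dynkin_payoff ::
  "'a measure \<Rightarrow> real \<Rightarrow> real \<Rightarrow> real \<Rightarrow> (real \<Rightarrow> real \<Rightarrow> real) \<Rightarrow> (real \<Rightarrow> 'a \<Rightarrow> real) \<Rightarrow>
   real \<Rightarrow> ('a \<Rightarrow> ennreal) \<Rightarrow> ('a \<Rightarrow> ennreal) \<Rightarrow> real" where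
  "dynkin_payoff M \<rho> qp qm gc X c \<sigma> \<tau> =
     (LINT \<omega>|M.
        (LINT t:{t. 0 \<le> t \<and> ennreal t \<le> min (\<sigma> \<omega>) (\<tau> \<omega>)}|lborel. exp (- \<rho> * t) * gc c (X t \<omega>))
        + (if \<sigma> \<omega> < \<tau> \<omega> then qm * discount \<rho> (\<sigma> \<omega>) else 0)
        - (if \<tau> \<omega> < \<sigma> \<omega> then qp * discount \<rho> (\<tau> \<omega>) else 0))"

definition dynkin_lower ::
  "'a measure \<Rightarrow> (ennreal \<Rightarrow> 'a measure) \<Rightarrow> real \<Rightarrow> real \<Rightarrow> real \<Rightarrow> (real \<Rightarrow> real \<Rightarrow> real) \<Rightarrow>
   (real \<Rightarrow> real \<Rightarrow> 'a \<Rightarrow> real) \<Rightarrow> real \<Rightarrow> real \<Rightarrow> ereal" where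
  "dynkin_lower M F \<rho> qp qm gc D c d =
     (SUP \<tau>\<in>{\<tau>. stopping_time F \<tau>}. INF \<sigma>\<in>{\<sigma>. stopping_time F \<sigma>}.
        ereal (dynkin_payoff M \<rho> qp qm gc (D d) c \<sigma> \<tau>))"

definition dynkin_upper ::
  "'a measure \<Rightarrow> (ennreal \<Rightarrow> 'a measure) \<Rightarrow> real \<Rightarrow> real \<Rightarrow> real \<Rightarrow> (real \<Rightarrow> real \<Rightarrow> real) \<Rightarrow>
   (real \<Rightarrow> real \<Rightarrow> 'a \<Rightarrow> real) \<Rightarrow> real \<Rightarrow> real \<Rightarrow> ereal" where
  "dynkin_upper M F \<rho> qp qm gc D c d =
     (INF \<sigma>\<in>{\<sigma>. stopping_time F \<sigma>}. SUP \<tau>\<in>{\<tau>. stopping_time F \<tau>}.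
        ereal (dynkin_payoff M \<rho> qp qm gc (D d) c \<sigma> \<tau>))"

definition dynkin_has_value ::
  "'a measure \<Rightarrow> (ennreal \<Rightarrow> 'a measure) \<Rightarrow> real \<Rightarrow> real \<Rightarrow> real \<Rightarrow> (real \<Rightarrow> real \<Rightarrow> real) \<Rightarrow>
   (real \<Rightarrow> real \<Rightarrow> 'a \<Rightarrow> real) \<Rightarrow> real \<Rightarrow> real \<Rightarrow> real \<Rightarrow> bool" where
  "dynkin_has_value M F \<rho> qp qm gc D c d w \<longleftrightarrow>
     dynkin_lower M F \<rho> qp qm gc D c d = ereal w \<and>
     dynkin_upper M F \<rho> qp qm gc D c d = ereal w"

definition first_positive_time :: "(real \<Rightarrow> real) \<Rightarrow> ennreal" where
  "first_positive_time f = Inf {ennreal t | t. 0 \<le> t \<and> f t > 0}"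

section \<open>Standing assumptions\<close>

text \<open>\<open>|x|\<^sup>\<nu>\<close> with \<open>|0|\<^sup>0 = 1\<close>, whereas \<open>0 powr 0 = 0\<close>.\<close>

definition abs_pow :: "real \<Rightarrow> real \<Rightarrow> real" where
  "abs_pow x \<nu> = (if \<nu> = 0 then 1 else \<bar>x\<bar> powr \<nu>)"

definition locally_bounded :: "(real \<Rightarrow> real) \<Rightarrow> bool" where
  "locally_bounded f \<longleftrightarrow> (\<forall>x. \<exists>U. open U \<and> x \<in> U \<and> bounded (f ` U))"

locale capacity_setting = prob_space M + filtration "space M" F
  for M :: "'a measure" and F :: "ennreal \<Rightarrow> 'a measure" +
  fixes W :: "real \<Rightarrow> 'a \<Rightarrow> real"
    and dmin dmax :: ereal
    and \<mu> \<Sigma> :: "real \<Rightarrow> real"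
    and D :: "real \<Rightarrow> real \<Rightarrow> 'a \<Rightarrow> real"
    and g gc :: "real \<Rightarrow> real \<Rightarrow> real"
    and \<gamma>0 \<eta>0 :: "real \<Rightarrow> real"
    and \<nu> K0 K1 \<rho> qp qm :: real
  assumes F_sub: "\<And>t. sets (F t) \<subseteq> sets M"
    and usual: "usual_conditions M F"
    and W_BM: "brownian_motion M F W"
    and dmin_dmax: "dmin < dmax"
    and \<mu>_cont: "continuous_on (open_interval dmin dmax) \<mu>"
    and \<Sigma>_cont: "continuous_on (open_interval dmin dmax) \<Sigma>"
    and linear_growth: "\<exists>L. \<forall>x\<in>open_interval dmin dmax. \<bar>\<mu> x\<bar> + \<bar>\<Sigma> x\<bar> \<le> L * (1 + \<bar>x\<bar>)"
    and D_solution: "\<And>d. d \<in> open_interval dmin dmax \<Longrightarrow>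
          sde_solution M F W (open_interval dmin dmax) \<mu> \<Sigma> d (D d)"
    and D_unique: "\<And>d Y. d \<in> open_interval dmin dmax \<Longrightarrow>
          sde_solution M F W (open_interval dmin dmax) \<mu> \<Sigma> d Y \<Longrightarrow>
          (AE \<omega> in M. \<forall>t\<ge>0. Y t \<omega> = D d t \<omega>)"
    and D_continuous: "\<And>x d t. (\<And>n. x n \<in> open_interval dmin dmax) \<Longrightarrow>
          d \<in> open_interval dmin dmax \<Longrightarrow> x \<longlonglongrightarrow> d \<Longrightarrow> 0 \<le> t \<Longrightarrow>
          (AE \<omega> in M. (\<lambda>n. D (x n) t \<omega>) \<longlonglongrightarrow> D d t \<omega>)"
    and D_comparison: "\<And>d d' t. d \<in> open_interval dmin dmax \<Longrightarrow>
          d' \<in> open_interval dmin dmax \<Longrightarrow> d \<le> d' \<Longrightarrow> 0 \<le> t \<Longrightarrow>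
          (AE \<omega> in M. D d t \<omega> \<le> D d' t \<omega>)"
    and D_regular: "regular_diffusion M (open_interval dmin dmax) D"
    and D_natural: "natural_boundaries M (open_interval dmin dmax) D"
    and g_nonneg: "\<And>c d. d \<in> open_interval dmin dmax \<Longrightarrow> 0 \<le> g c d"
    and g_cont: "continuous_on (UNIV \<times> open_interval dmin dmax) (\<lambda>(c, d). g c d)"
    and g_convex: "\<And>d. d \<in> open_interval dmin dmax \<Longrightarrow> convex_on UNIV (\<lambda>c. g c d)"
    and g_deriv: "\<And>c d. d \<in> open_interval dmin dmax \<Longrightarrow>
          ((\<lambda>x. g x d) has_real_derivative gc c d) (at c)"
    and gc_cont: "continuous_on (UNIV \<times> open_interval dmin dmax) (\<lambda>(c, d). gc c d)"
    and gc_antimono: "\<And>c. antimono_on (open_interval dmin dmax) (gc c)"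
    and growth_pos: "\<And>c. \<gamma>0 c > 0" "\<And>c. \<eta>0 c > 0"
    and growth_loc_bdd: "locally_bounded \<gamma>0" "locally_bounded \<eta>0"
    and nu_nonneg: "\<nu> \<ge> 0"
    and g_growth: "\<And>c d. d \<in> open_interval dmin dmax \<Longrightarrow>
          \<bar>g c d\<bar> + \<bar>gc c d\<bar> \<le> \<gamma>0 c + \<eta>0 c * abs_pow d \<nu>"
    and K0_nonneg: "K0 \<ge> 0"
    and D_moments: "\<And>d t. d \<in> open_interval dmin dmax \<Longrightarrow> 0 \<le> t \<Longrightarrow>
          (\<integral>\<^sup>+\<omega>. ennreal (abs_pow (D d t \<omega>) \<nu>) \<partial>M)
            \<le> ennreal (K0 * (1 + abs_pow d \<nu>) * exp (K1 * t))"
    and rho: "\<rho> > max K1 0"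
    and q_pos: "qp > 0" "qm > 0"

end

theory Submission
  imports Defs
begin

text \<open>
  Integration by parts turns the discounted control costs into \<open>\<integral> \<rho> e\<^sup>-\<^sup>\<rho>\<^sup>t (q\<^sup>+ I\<^sup>+\<^sub>t + q\<^sup>- I\<^sup>-\<^sub>t) dt\<close>.
  Let \<open>I\<close> be optimal at \<open>c\<close>, \<open>\<tau>*\<close> its first purchase time and \<open>\<sigma>\<close> any stopping time. Starting from
  \<open>c + \<epsilon>\<close>, the investor follows \<open>I\<close> except that the excess \<open>\<epsilon>\<close> replaces the first purchases of
  \<open>I\<close>, or is sold at time \<open>\<sigma>\<close> if \<open>\<sigma> < \<tau>*\<close>. By convexity of \<open>g\<close> the extra cost is at most \<open>\<epsilon>\<close> times
  an integral which tends to at most \<open>J(c,d;\<sigma>,\<tau>*)\<close>, so the upper right derivative of \<open>v\<close> at \<open>c\<close> is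
  at most \<open>J(c,d;\<sigma>,\<tau>*)\<close>. The reflection \<open>c \<mapsto> -c\<close>, \<open>I \<mapsto> -I\<close> swaps the players and bounds the lower
  left derivative from below by \<open>J(c,d;\<sigma>*,\<tau>)\<close>. Convexity of \<open>v\<close> gives the opposite order of the
  one-sided derivatives, hence all these quantities coincide at \<open>(\<sigma>*,\<tau>*)\<close>.
\<close>

section \<open>Saddle points and one-sided derivatives\<close>

lemma saddle_point_value:
  fixes J :: "'s \<Rightarrow> 't \<Rightarrow> 'v :: complete_lattice"
  assumes "s' \<in> S" "t' \<in> T"
    and "\<And>t. t \<in> T \<Longrightarrow> J s' t \<le> J s' t'"
    and "\<And>s. s \<in> S \<Longrightarrow> J s' t' \<le> J s t'"
  shows "(SUP t\<in>T. INF s\<in>S. J s t) = J s' t'" and "(INF s\<in>S. SUP t\<in>T. J s t) = J s' t'"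
proof -
  have "(SUP t\<in>T. INF s\<in>S. J s t) \<le> (INF s\<in>S. SUP t\<in>T. J s t)"
    by (intro SUP_least INF_greatest) (meson INF_lower SUP_upper order_trans)
  moreover have "(INF s\<in>S. SUP t\<in>T. J s t) \<le> J s' t'"
    by (rule INF_lower2[OF assms(1)]) (intro SUP_least assms(3))
  moreover have "J s' t' \<le> (SUP t\<in>T. INF s\<in>S. J s t)"
    by (rule SUP_upper2[OF assms(2)]) (intro INF_greatest assms(4))
  ultimately show "(SUP t\<in>T. INF s\<in>S. J s t) = J s' t'" "(INF s\<in>S. SUP t\<in>T. J s t) = J s' t'"
    by (auto intro: antisym order_trans)
qed

definition upper_right_dini :: "(real \<Rightarrow> real) \<Rightarrow> real \<Rightarrow> ereal" where
  "upper_right_dini f x = Limsup (at_right 0) (\<lambda>h. ereal ((f (x + h) - f x) / h))"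

definition lower_left_dini :: "(real \<Rightarrow> real) \<Rightarrow> real \<Rightarrow> ereal" where
  "lower_left_dini f x = Liminf (at_left 0) (\<lambda>h. ereal ((f (x + h) - f x) / h))"

lemma lower_left_dini_at_right:
  "lower_left_dini f x = Liminf (at_right 0) (\<lambda>h. ereal ((f x - f (x - h)) / h))"
  unfolding lower_left_dini_def at_left_minus[of 0]
  by (subst Liminf_filtermap_eq) (auto intro!: arg_cong2[where f=Liminf] simp: minus_divide_left)

lemma lower_left_dini_mirror: "lower_left_dini f x = - upper_right_dini (\<lambda>y. f (- y)) (- x)"
  unfolding lower_left_dini_at_right upper_right_dini_def ereal_Liminf_uminus[symmetric]
  by (simp add: minus_divide_left)

lemma convex_on_left_slope_le_right_slope:
  fixes f :: "real \<Rightarrow> real"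
  assumes "convex_on UNIV f" "0 < h"
  shows "(f x - f (x - h)) / h \<le> (f (x + h) - f x) / h"
proof -
  have "f ((1 - 1/2) *\<^sub>R (x - h) + (1/2) *\<^sub>R (x + h)) \<le> (1 - 1/2) * f (x - h) + 1/2 * f (x + h)"
    by (rule convex_onD[OF assms(1)]) auto
  moreover have "(1 - 1/2) *\<^sub>R (x - h) + (1/2) *\<^sub>R (x + h) = x" by (simp add: field_simps)
  ultimately show ?thesis using \<open>0 < h\<close> by (intro divide_right_mono) auto
qed

lemma eventually_left_slope_le_right_slope:
  fixes f :: "real \<Rightarrow> real"
  assumes "convex_on UNIV f"
  shows "\<forall>\<^sub>F h in at_right 0. ereal ((f x - f (x - h)) / h) \<le> ereal ((f (x + h) - f x) / h)"
  using eventually_at_right_less[of "0 :: real"]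
  by eventually_elim (simp add: convex_on_left_slope_le_right_slope[OF assms])

lemma convex_on_lower_left_le_upper_right_dini:
  assumes "convex_on UNIV f"
  shows "lower_left_dini f x \<le> upper_right_dini f x"
  unfolding lower_left_dini_at_right upper_right_dini_def
  using Liminf_mono[OF eventually_left_slope_le_right_slope[OF assms]]
    Liminf_le_Limsup[OF trivial_limit_at_right_real]
  by (rule order_trans)

lemma tendsto_squeeze_Liminf_Limsup:
  fixes w :: "'v :: {complete_linorder, linorder_topology}"
  assumes "F \<noteq> bot" and le: "\<forall>\<^sub>F h in F. X h \<le> Y h"
    and "w \<le> Liminf F X" and "Limsup F Y \<le> w"
  shows "(X \<longlongrightarrow> w) F" and "(Y \<longlongrightarrow> w) F"
proof -
  have "Liminf F X \<le> Limsup F X" "Liminf F Y \<le> Limsup F Y"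
    using assms(1) by (auto intro: Liminf_le_Limsup)
  then have "Liminf F X = w \<and> Limsup F X = w \<and> Liminf F Y = w \<and> Limsup F Y = w"
    using assms(3,4) Liminf_mono[OF le] Limsup_mono[OF le] by (meson antisym order_trans)
  then show "(X \<longlongrightarrow> w) F" "(Y \<longlongrightarrow> w) F"
    using Liminf_eq_Limsup[OF assms(1)] by blast+
qed

lemma convex_on_has_real_derivative_dini:
  assumes convex: "convex_on UNIV f"
    and upper: "upper_right_dini f x \<le> ereal w" and lower: "ereal w \<le> lower_left_dini f x"
  shows "(f has_real_derivative w) (at x)"
proof -
  note limits = tendsto_squeeze_Liminf_Limsup[OF trivial_limit_at_right_real
      eventually_left_slope_le_right_slope[OF convex]
      lower[unfolded lower_left_dini_at_right] upper[unfolded upper_right_dini_def]]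
  have "((\<lambda>h. (f (x + h) - f x) / h) \<longlongrightarrow> w) (at_right 0)"
    using limits(2) by simp
  moreover have "((\<lambda>h. (f (x + - h) - f x) / - h) \<longlongrightarrow> w) (at_right 0)"
    using limits(1) by (simp add: minus_divide_left)
  ultimately show ?thesis
    unfolding DERIV_def filterlim_at_split filterlim_at_left_to_right by simp
qed

section \<open>Increasing paths\<close>

definition increasing_path :: "(real \<Rightarrow> real) \<Rightarrow> bool" where
  "increasing_path H \<longleftrightarrow>
     mono_on {0..} H \<and> 0 \<le> H 0 \<and> (\<forall>t\<ge>0. continuous (at_right t) H)"

lemma increasing_path_mono: "increasing_path H \<Longrightarrow> 0 \<le> r \<Longrightarrow> r \<le> s \<Longrightarrow> H r \<le> H s"
  unfolding increasing_path_def using mono_onD[of "{0..}" H r s] by auto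

lemma increasing_path_nonneg: "increasing_path H \<Longrightarrow> 0 \<le> t \<Longrightarrow> 0 \<le> H t"
  using increasing_path_mono[of H 0 t] by (simp add: increasing_path_def)

lemma ext0_increasing_path_nonneg: "increasing_path H \<Longrightarrow> 0 \<le> ext0 H t"
  by (simp add: ext0_def increasing_path_nonneg)

lemma mono_ext0_increasing_path:
  assumes "increasing_path H"
  shows "mono (ext0 H)"
proof
  fix a b :: real assume "a \<le> b"
  then show "ext0 H a \<le> ext0 H b"
    using increasing_path_nonneg[OF assms, of b] increasing_path_mono[OF assms, of a b]
    by (auto simp: ext0_def)
qed

lemma continuous_at_right_ext0:
  assumes "\<And>t. 0 \<le> t \<Longrightarrow> continuous (at_right t) f"
  shows "continuous (at_right t) (ext0 f)"
proof (cases "t < 0")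
  case True
  have "\<forall>\<^sub>F x in at_right t. ext0 f t = ext0 f x"
    using True by (auto simp: eventually_at_right ext0_def intro!: exI[of _ 0])
  then show ?thesis
    unfolding continuous_within by (rule Lim_transform_eventually[OF tendsto_const])
next
  case False
  have "\<forall>\<^sub>F x in at_right t. f x = ext0 f x"
    using False by (intro eventually_at_right_less[THEN eventually_mono]) (auto simp: ext0_def)
  moreover have "(f \<longlongrightarrow> ext0 f t) (at_right t)"
    using assms[of t] False by (simp add: continuous_within ext0_def)
  ultimately show ?thesis
    unfolding continuous_within by (rule Lim_transform_eventually[rotated])
qed

lemma continuous_at_right_ext0_increasing_path:
  "increasing_path H \<Longrightarrow> continuous (at_right t) (ext0 H)"
  by (rule continuous_at_right_ext0) (simp add: increasing_path_def)

lemma cadlag_increasing_path: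
  assumes H: "increasing_path H"
  shows "cadlag H"
  unfolding cadlag_def
proof (intro conjI allI impI)
  fix t :: real assume "0 < t"
  have "(H \<longlongrightarrow> Sup (H ` ({..<t} \<inter> {0..}))) (at t within ({..<t} \<inter> {0..}))"
    by (rule Lim_left_bound[where K="H t"])
      (use H \<open>0 < t\<close> in \<open>auto simp: increasing_path_def intro: mono_onD\<close>)
  moreover have "at t within ({..<t} \<inter> {0..}) = at_left t"
    by (rule at_within_nhd[where S="{0<..}"]) (use \<open>0 < t\<close> in auto)
  ultimately show "\<exists>l. (H \<longlongrightarrow> l) (at_left t)" by auto
qed (use H in \<open>simp add: increasing_path_def\<close>)

lemma cadlag_uminus: "cadlag f \<Longrightarrow> cadlag (\<lambda>t. - f t)"
  unfolding cadlag_def by (blast intro: continuous_minus tendsto_minus)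

lemma cadlag_diff:
  assumes "cadlag f" "cadlag g"
  shows "cadlag (\<lambda>t. f t - g t)"
  unfolding cadlag_def
proof (intro conjI allI impI)
  show "continuous (at_right t) (\<lambda>t. f t - g t)" if "0 \<le> t" for t
    using assms that by (simp add: cadlag_def continuous_diff)
  show "\<exists>l. ((\<lambda>t. f t - g t) \<longlongrightarrow> l) (at_left t)" if "0 < t" for t
  proof -
    obtain l m where "(f \<longlongrightarrow> l) (at_left t)" "(g \<longlongrightarrow> m) (at_left t)"
      using assms \<open>0 < t\<close> unfolding cadlag_def by blast
    from tendsto_diff[OF this] show ?thesis by blast
  qed
qed

lemma cadlag_cong:
  assumes eq: "\<And>t. 0 \<le> t \<Longrightarrow> f t = g t" and g: "cadlag g"
  shows "cadlag f"
  unfolding cadlag_def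
proof (intro conjI allI impI)
  fix t :: real assume t: "0 \<le> t"
  have "(f \<longlongrightarrow> f t) (at_right t) \<longleftrightarrow> (g \<longlongrightarrow> g t) (at_right t)"
    using t eq
    by (intro filterlim_cong eventually_at_right_less[THEN eventually_mono]) auto
  then show "continuous (at_right t) f"
    using g t by (simp add: cadlag_def continuous_within)
next
  fix t :: real assume t: "0 < t"
  then obtain l where "(g \<longlongrightarrow> l) (at_left t)" using g by (auto simp: cadlag_def)
  moreover have "(f \<longlongrightarrow> l) (at_left t) \<longleftrightarrow> (g \<longlongrightarrow> l) (at_left t)"
    using t eq by (intro filterlim_cong) (auto simp: eventually_at_left intro!: exI[of _ 0])
  ultimately show "\<exists>l. (f \<longlongrightarrow> l) (at_left t)" by auto
qed

lemma increasing_path_zero: "increasing_path (\<lambda>_. 0)"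
  by (simp add: increasing_path_def mono_onI)

lemma increasing_path_add:
  assumes "increasing_path A" "increasing_path B"
  shows "increasing_path (\<lambda>t. A t + B t)"
  using assms unfolding increasing_path_def
  by (auto intro!: mono_onI add_mono continuous_intros intro: mono_onD)

lemma increasing_path_cmult:
  assumes "0 \<le> k" "increasing_path A"
  shows "increasing_path (\<lambda>t. k * A t)"
  using assms unfolding increasing_path_def
  by (auto intro!: mono_onI mult_left_mono continuous_intros intro: mono_onD)

lemma increasing_path_excess:
  assumes "increasing_path A"
  shows "increasing_path (\<lambda>t. A t - min k (A t))"
  unfolding increasing_path_def
proof (intro conjI allI impI)
  show "mono_on {0..} (\<lambda>t. A t - min k (A t))"
  proof (rule mono_onI)
    fix r s :: real assume "r \<in> {0..}" "s \<in> {0..}" "r \<le> s"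
    then have "A r \<le> A s" using increasing_path_mono[OF assms] by simp
    then show "A r - min k (A r) \<le> A s - min k (A s)" by linarith
  qed
qed (use assms in \<open>auto simp: increasing_path_def intro!: continuous_intros\<close>)

lemma increasing_path_step: "increasing_path (\<lambda>t. if a \<le> ennreal t then 1 else 0)"
  unfolding increasing_path_def
proof (intro conjI allI impI)
  show "mono_on {0..} (\<lambda>t. if a \<le> ennreal t then 1 else 0 :: real)"
  proof (rule mono_onI)
    fix r s :: real assume "r \<le> s"
    then show "(if a \<le> ennreal r then 1 else 0 :: real) \<le> (if a \<le> ennreal s then 1 else 0)"
      using ennreal_leI[of r s] by auto
  qed
  fix t :: real assume t: "0 \<le> t"
  have "\<forall>\<^sub>F s in at_right t. a \<le> ennreal s \<longleftrightarrow> a \<le> ennreal t"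
  proof (cases a)
    case (real r)
    have "\<forall>\<^sub>F s in at_right t. t < s \<and> (t < r \<longrightarrow> s < r)"
      by (auto simp: eventually_conj_iff eventually_at_right_less eventually_at_right_real
          intro: eventually_mono[OF eventually_at_right_real])
    then show ?thesis by eventually_elim (use real t in auto)
  qed (simp add: top_unique)
  then have "\<forall>\<^sub>F s in at_right t.
      (if a \<le> ennreal t then 1 else 0 :: real) = (if a \<le> ennreal s then 1 else 0)"
    by eventually_elim simp
  then show "continuous (at_right t) (\<lambda>t. if a \<le> ennreal t then 1 else 0 :: real)"
    unfolding continuous_within by (rule Lim_transform_eventually[OF tendsto_const])
qed simp

section \<open>Positive and negative variation\<close>

definition upward_sum :: "(real \<Rightarrow> real) \<Rightarrow> nat \<Rightarrow> (nat \<Rightarrow> real) \<Rightarrow> real" where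
  "upward_sum f n p = (\<Sum>i<n. max 0 (ext0 f (p (Suc i)) - ext0 f (p i)))"

lemma pos_variation_eq_SUP:
  "pos_variation f t = (SUP (n, p)\<in>partitions_upto t. upward_sum f n p)"
  by (simp add: pos_variation_def upward_sum_def)

lemma ext0_uminus: "ext0 (\<lambda>s. - f s) t = - ext0 f t"
  by (simp add: ext0_def)

lemma pos_variation_uminus [simp]: "pos_variation (\<lambda>s. - f s) = neg_variation f"
  by (rule ext) (simp add: neg_variation_def pos_variation_def ext0_uminus)

lemma neg_variation_uminus [simp]: "neg_variation (\<lambda>s. - f s) = pos_variation f"
  by (rule ext) (simp add: neg_variation_def pos_variation_def ext0_uminus)

lemma bounded_variation_upto_uminus:
  "bounded_variation_upto (\<lambda>s. - f s) t \<longleftrightarrow> bounded_variation_upto f t"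
  by (simp add: bounded_variation_upto_def ext0_uminus abs_minus_commute)

lemma partition_mono:
  assumes "(n, p) \<in> partitions_upto t" "i \<le> j" "j \<le> n"
  shows "p i \<le> p j"
  using assms(2,3)
proof (induction rule: inc_induct)
  case (step m)
  then have "p m \<le> p (Suc m)" using assms(1) by (simp add: partitions_upto_def)
  then show ?case using step by linarith
qed simp

lemma partition_le: "(n, p) \<in> partitions_upto t \<Longrightarrow> i \<le> n \<Longrightarrow> p i \<le> t"
  using partition_mono[of n p t i n] by (auto simp: partitions_upto_def)

lemma trivial_partition: "(0, \<lambda>_. t) \<in> partitions_upto t"
  by (simp add: partitions_upto_def)

lemma partition_sum_le:
  fixes \<phi> :: "real \<Rightarrow> real \<Rightarrow> real"
  assumes np: "(n, p) \<in> partitions_upto t" and nonneg: "\<And>s. 0 \<le> Q s"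
    and step: "\<And>a b. a \<le> b \<Longrightarrow> b \<le> t \<Longrightarrow> 0 \<le> \<phi> a b \<and> \<phi> a b \<le> Q b - Q a"
  shows "(\<Sum>i<n. \<phi> (p i) (p (Suc i))) \<le> Q t"
proof -
  have "\<phi> (p i) (p (Suc i)) \<le> Q (p (Suc i)) - Q (p i)" if "i < n" for i
    using step[of "p i" "p (Suc i)"] that
      partition_mono[OF np, of i "Suc i"] partition_le[OF np, of "Suc i"] by simp
  then have "(\<Sum>i<n. \<phi> (p i) (p (Suc i))) \<le> (\<Sum>i<n. Q (p (Suc i)) - Q (p i))"
    by (intro sum_mono) simp
  also have "\<dots> = Q (p n) - Q (p 0)" by (rule sum_lessThan_telescope)
  also have "\<dots> \<le> Q t"
    using step[of "p n" t] partition_le[OF np order_refl] nonneg[of "p 0"] by auto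
  finally show ?thesis .
qed

lemma bounded_variation_uptoI:
  assumes "\<And>s. 0 \<le> Q s"
    and "\<And>a b. a \<le> b \<Longrightarrow> b \<le> t \<Longrightarrow> \<bar>ext0 f b - ext0 f a\<bar> \<le> Q b - Q a"
  shows "bounded_variation_upto f t"
  unfolding bounded_variation_upto_def
  by (rule bdd_aboveI[of _ "Q t"])
    (use partition_sum_le[where Q=Q and \<phi>="\<lambda>a b. \<bar>ext0 f b - ext0 f a\<bar>"] assms in auto)

lemma pos_variation_least:
  assumes "\<And>n p. (n, p) \<in> partitions_upto t \<Longrightarrow> upward_sum f n p \<le> K"
  shows "pos_variation f t \<le> K"
  unfolding pos_variation_eq_SUP by (rule cSUP_least) (use trivial_partition assms in auto)

lemma pos_variation_minimal:
  assumes "\<And>s. 0 \<le> Q s"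
    and "\<And>a b. a \<le> b \<Longrightarrow> b \<le> t \<Longrightarrow> max 0 (ext0 f b - ext0 f a) \<le> Q b - Q a"
  shows "pos_variation f t \<le> Q t"
  by (rule pos_variation_least, unfold upward_sum_def)
    (rule partition_sum_le[where \<phi>="\<lambda>a b. max 0 (ext0 f b - ext0 f a)"], use assms in auto)

lemma upward_sum_le_pos_variation:
  assumes "bounded_variation_upto f t" "(n, p) \<in> partitions_upto t"
  shows "upward_sum f n p \<le> pos_variation f t"
proof -
  obtain B where B: "\<And>n p. (n, p) \<in> partitions_upto t \<Longrightarrow>
      (\<Sum>i<n. \<bar>ext0 f (p (Suc i)) - ext0 f (p i)\<bar>) \<le> B"
    using assms(1) unfolding bounded_variation_upto_def bdd_above_def by force
  have "upward_sum f n p \<le> B" if "(n, p) \<in> partitions_upto t" for n p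
    unfolding upward_sum_def by (rule order_trans[OF sum_mono B[OF that]]) auto
  then have "bdd_above ((\<lambda>(n, p). upward_sum f n p) ` partitions_upto t)"
    by (intro bdd_aboveI[of _ B]) auto
  from cSUP_upper[OF assms(2) this] show ?thesis by (simp add: pos_variation_eq_SUP)
qed

lemma pos_variation_increment:
  assumes bv: "bounded_variation_upto f b" and ab: "a \<le> b"
  shows "max 0 (ext0 f b - ext0 f a) \<le> pos_variation f b - pos_variation f a"
proof -
  have "pos_variation f a \<le> pos_variation f b - max 0 (ext0 f b - ext0 f a)"
  proof (rule pos_variation_least)
    fix n p assume np: "(n, p) \<in> partitions_upto a"
    define p' where "p' i = (if i \<le> n then p i else if i = Suc n then a else b)" for i
    have "(Suc (Suc n), p') \<in> partitions_upto b"
      using np ab by (auto simp: partitions_upto_def p'_def less_Suc_eq)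
    from upward_sum_le_pos_variation[OF bv this]
    have "upward_sum f n p + max 0 (ext0 f a - ext0 f (p n)) + max 0 (ext0 f b - ext0 f a)
        \<le> pos_variation f b"
      by (simp add: upward_sum_def p'_def)
    then show "upward_sum f n p \<le> pos_variation f b - max 0 (ext0 f b - ext0 f a)" by linarith
  qed
  then show ?thesis by linarith
qed

lemma pos_variation_neg_time:
  assumes "t < 0"
  shows "pos_variation f t = 0"
proof (rule antisym)
  show "pos_variation f t \<le> 0"
    using pos_variation_minimal[of "\<lambda>_. 0" t f] assms by (simp add: ext0_def)
  have "bounded_variation_upto f t"
    by (rule bounded_variation_uptoI[of "\<lambda>_. 0"]) (use assms in \<open>auto simp: ext0_def\<close>)
  from upward_sum_le_pos_variation[OF this trivial_partition]
  show "0 \<le> pos_variation f t" by (simp add: upward_sum_def)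
qed

lemma neg_variation_neg_time: "t < 0 \<Longrightarrow> neg_variation f t = 0"
  using pos_variation_neg_time[of t "\<lambda>s. - f s"] by simp

locale bv_path =
  fixes f :: "real \<Rightarrow> real"
  assumes bv: "\<And>T. 0 \<le> T \<Longrightarrow> bounded_variation_upto f T"
begin

lemma bounded_variation: "bounded_variation_upto f t"
proof (cases "0 \<le> t")
  case False
  have "partitions_upto t \<subseteq> partitions_upto 0"
    using False by (auto simp: partitions_upto_def)
  then show ?thesis
    using bdd_above_mono[OF bv[OF order_refl, unfolded bounded_variation_upto_def] image_mono]
    by (simp add: bounded_variation_upto_def)
qed (rule bv)

lemma bv_path_uminus: "bv_path (\<lambda>s. - f s)"
  by standard (simp add: bounded_variation_upto_uminus bv)

lemma pos_increment: "a \<le> b \<Longrightarrow> max 0 (ext0 f b - ext0 f a) \<le> pos_variation f b - pos_variation f a"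
  by (rule pos_variation_increment[OF bounded_variation])

lemma neg_increment: "a \<le> b \<Longrightarrow> max 0 (ext0 f a - ext0 f b) \<le> neg_variation f b - neg_variation f a"
  using bv_path.pos_increment[OF bv_path_uminus, of a b] by (simp add: ext0_uminus)

lemma mono_pos_variation: "mono (pos_variation f)"
proof
  show "pos_variation f a \<le> pos_variation f b" if "a \<le> b" for a b
    using pos_increment[OF that] by linarith
qed

lemma pos_variation_nonneg: "0 \<le> pos_variation f t"
  using monoD[OF mono_pos_variation, of "min (-1) t" t] pos_variation_neg_time[of "min (-1) t" f]
  by auto

lemma pos_variation_le_neg_variation: "pos_variation f t \<le> neg_variation f t + ext0 f t"
proof (rule pos_variation_minimal)
  have increasing: "neg_variation f a + ext0 f a \<le> neg_variation f b + ext0 f b" if "a \<le> b" for a b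
    using neg_increment[OF that] by linarith
  show "0 \<le> neg_variation f s + ext0 f s" for s
    using increasing[of "min (-1) s" s] neg_variation_neg_time[of "min (-1) s" f]
    by (auto simp: ext0_def min_def split: if_splits)
  show "max 0 (ext0 f b - ext0 f a) \<le> neg_variation f b + ext0 f b - (neg_variation f a + ext0 f a)"
    if "a \<le> b" for a b
    using increasing[OF that] neg_increment[OF that] by linarith
qed

lemma jordan_decomposition:
  assumes "0 \<le> t"
  shows "f t = pos_variation f t - neg_variation f t"
  using pos_variation_le_neg_variation[of t] assms
    bv_path.pos_variation_le_neg_variation[OF bv_path_uminus, of t]
  by (simp add: ext0_def)

end

locale cadlag_bv_path = bv_path +
  assumes cadlag: "cadlag f"
begin

lemma cadlag_bv_path_uminus: "cadlag_bv_path (\<lambda>s. - f s)"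
  using bv_path_uminus cadlag_uminus[OF cadlag]
  by (simp add: cadlag_bv_path_def cadlag_bv_path_axioms_def)

lemma ext0_tendsto_at_right: "(ext0 f \<longlongrightarrow> ext0 f t) (at_right t)"
  using continuous_at_right_ext0[of f t] cadlag by (simp add: cadlag_def continuous_within)

lemma increment_le_pos_variation_right_limit:
  assumes lim: "(pos_variation f \<longlongrightarrow> L) (at_right t)" and "t < b"
  shows "ext0 f b - ext0 f t \<le> pos_variation f b - L"
proof (rule tendsto_le[OF trivial_limit_at_right_real])
  show "((\<lambda>s. pos_variation f b - pos_variation f s) \<longlongrightarrow> pos_variation f b - L) (at_right t)"
    by (intro tendsto_intros lim)
  show "((\<lambda>s. ext0 f b - ext0 f s) \<longlongrightarrow> ext0 f b - ext0 f t) (at_right t)"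
    by (intro tendsto_intros ext0_tendsto_at_right)
  show "\<forall>\<^sub>F s in at_right t. ext0 f b - ext0 f s \<le> pos_variation f b - pos_variation f s"
    unfolding eventually_at_right[OF \<open>t < b\<close>]
  proof (intro exI[of _ b] conjI allI impI \<open>t < b\<close>)
    show "ext0 f b - ext0 f s \<le> pos_variation f b - pos_variation f s" if "t < s" "s < b" for s
      using pos_increment[of s b] that by linarith
  qed
qed

text \<open>A right jump of the positive variation could be cut out, contradicting minimality.\<close>

lemma continuous_at_right_pos_variation: "continuous (at_right t) (pos_variation f)"
proof -
  define L where "L = Inf (pos_variation f ` {t<..})"
  have lim: "(pos_variation f \<longlongrightarrow> L) (at_right t)"
    using Lim_right_bound[of UNIV t "pos_variation f" 0] pos_variation_nonneg
      monoD[OF mono_pos_variation] by (auto simp: L_def)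
  have L_le: "L \<le> pos_variation f b" if "t < b" for b
    unfolding L_def
    by (rule cINF_lower) (use that pos_variation_nonneg in \<open>auto intro: bdd_belowI[of _ 0]\<close>)
  have le_L: "pos_variation f t \<le> L"
    unfolding L_def by (rule cINF_greatest) (auto intro: monoD[OF mono_pos_variation])
  define Q where "Q s = pos_variation f s - (if s \<le> t then 0 else L - pos_variation f t)" for s
  have "pos_variation f (t + 1) \<le> Q (t + 1)"
  proof (rule pos_variation_minimal)
    show "0 \<le> Q s" for s
      using pos_variation_nonneg[of s] pos_variation_nonneg[of t] L_le[of s] by (auto simp: Q_def)
    show "max 0 (ext0 f b - ext0 f a) \<le> Q b - Q a" if "a \<le> b" for a b
    proof (cases "a \<le> t \<and> t < b")
      case True
      then show ?thesis
        using increment_le_pos_variation_right_limit[OF lim, of b] L_le[of b] pos_increment[of a t]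
        by (auto simp: Q_def)
    next
      case False
      then show ?thesis using pos_increment[OF that] that by (auto simp: Q_def)
    qed
  qed
  then have "L = pos_variation f t" using le_L by (simp add: Q_def)
  then show ?thesis using lim by (simp add: continuous_within)
qed

lemma increasing_path_pos_variation: "increasing_path (pos_variation f)"
  using mono_pos_variation continuous_at_right_pos_variation pos_variation_nonneg
  by (auto simp: increasing_path_def mono_def intro: mono_onI)

lemma increasing_path_neg_variation: "increasing_path (neg_variation f)"
  using cadlag_bv_path.increasing_path_pos_variation[OF cadlag_bv_path_uminus] by simp

end

lemma
  assumes A: "increasing_path A" and B: "increasing_path B"
    and f: "\<And>t. 0 \<le> t \<Longrightarrow> f t = A t - B t" and "a \<le> b"
  shows abs_increment_difference_le:
      "\<bar>ext0 f b - ext0 f a\<bar> \<le> (ext0 A b + ext0 B b) - (ext0 A a + ext0 B a)"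
    and pos_increment_difference_le: "max 0 (ext0 f b - ext0 f a) \<le> ext0 A b - ext0 A a"
proof -
  have "ext0 f s = ext0 A s - ext0 B s" for s using f by (simp add: ext0_def)
  then show "\<bar>ext0 f b - ext0 f a\<bar> \<le> (ext0 A b + ext0 B b) - (ext0 A a + ext0 B a)"
    "max 0 (ext0 f b - ext0 f a) \<le> ext0 A b - ext0 A a"
    using monoD[OF mono_ext0_increasing_path[OF A] \<open>a \<le> b\<close>]
      monoD[OF mono_ext0_increasing_path[OF B] \<open>a \<le> b\<close>] by simp_all
qed

lemma cadlag_bv_path_difference:
  assumes "increasing_path A" "increasing_path B" and f: "\<And>t. 0 \<le> t \<Longrightarrow> f t = A t - B t"
  shows "cadlag_bv_path f"
proof
  show "cadlag f"
    by (rule cadlag_cong[OF f cadlag_diff[OF assms(1,2)[THEN cadlag_increasing_path]]])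
  show "bounded_variation_upto f T" for T
    by (rule bounded_variation_uptoI[of "\<lambda>s. ext0 A s + ext0 B s"])
      (use assms(1,2) abs_increment_difference_le[OF assms] in
        \<open>auto simp: ext0_increasing_path_nonneg\<close>)
qed

lemma pos_variation_difference_le:
  assumes "increasing_path A" "increasing_path B" and "\<And>t. 0 \<le> t \<Longrightarrow> f t = A t - B t" and "0 \<le> t"
  shows "pos_variation f t \<le> A t"
proof -
  have "pos_variation f t \<le> ext0 A t"
    by (rule pos_variation_minimal)
      (use assms(1) pos_increment_difference_le[OF assms(1-3)] in
        \<open>auto simp: ext0_increasing_path_nonneg\<close>)
  then show ?thesis using \<open>0 \<le> t\<close> by (simp add: ext0_def)
qed

lemma neg_variation_difference_le:
  assumes "increasing_path A" "increasing_path B" and "\<And>t. 0 \<le> t \<Longrightarrow> f t = A t - B t" and "0 \<le> t"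
  shows "neg_variation f t \<le> B t"
  using pos_variation_difference_le[OF assms(2,1) _ assms(4), of "\<lambda>s. - f s"] assms(3) by simp

lemma
  assumes f: "cadlag_bv_path f" and h: "cadlag_bv_path h" and "0 \<le> a" "0 \<le> b"
  shows cadlag_bv_path_nonneg_combination: "cadlag_bv_path (\<lambda>t. a * f t + b * h t)"
    and pos_variation_nonneg_combination_le:
      "0 \<le> t \<Longrightarrow> pos_variation (\<lambda>t. a * f t + b * h t) t
        \<le> a * pos_variation f t + b * pos_variation h t"
    and neg_variation_nonneg_combination_le:
      "0 \<le> t \<Longrightarrow> neg_variation (\<lambda>t. a * f t + b * h t) t
        \<le> a * neg_variation f t + b * neg_variation h t"
proof -
  interpret f: cadlag_bv_path f by (rule f)
  interpret h: cadlag_bv_path h by (rule h)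
  have pos: "increasing_path (\<lambda>t. a * pos_variation f t + b * pos_variation h t)"
    using assms(3,4) f.increasing_path_pos_variation h.increasing_path_pos_variation
    by (intro increasing_path_add increasing_path_cmult)
  have neg: "increasing_path (\<lambda>t. a * neg_variation f t + b * neg_variation h t)"
    using assms(3,4) f.increasing_path_neg_variation h.increasing_path_neg_variation
    by (intro increasing_path_add increasing_path_cmult)
  have difference: "a * f t + b * h t = (a * pos_variation f t + b * pos_variation h t)
      - (a * neg_variation f t + b * neg_variation h t)" if "0 \<le> t" for t
    unfolding f.jordan_decomposition[OF that] h.jordan_decomposition[OF that]
    by (simp add: algebra_simps)
  show "cadlag_bv_path (\<lambda>t. a * f t + b * h t)"
    by (rule cadlag_bv_path_difference[OF pos neg difference])
  show "0 \<le> t \<Longrightarrow> pos_variation (\<lambda>t. a * f t + b * h t) t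
      \<le> a * pos_variation f t + b * pos_variation h t"
    by (rule pos_variation_difference_le[OF pos neg difference])
  show "0 \<le> t \<Longrightarrow> neg_variation (\<lambda>t. a * f t + b * h t) t
      \<le> a * neg_variation f t + b * neg_variation h t"
    by (rule neg_variation_difference_le[OF pos neg difference])
qed

section \<open>Right-continuous processes and stopping times\<close>

definition upper_grid :: "nat \<Rightarrow> real \<Rightarrow> rat" where
  "upper_grid k x = (of_int \<lfloor>x * real (Suc k)\<rfloor> + 1) / of_nat (Suc k)"

lemma of_rat_upper_grid:
  "real_of_rat (upper_grid k x) = (of_int \<lfloor>x * real (Suc k)\<rfloor> + 1) / real (Suc k)"
  by (simp add: upper_grid_def of_rat_divide of_rat_add)

lemma upper_grid_greater: "x < real_of_rat (upper_grid k x)"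
  using floor_correct[of "x * real (Suc k)"] by (simp add: of_rat_upper_grid field_simps)

lemma upper_grid_le: "real_of_rat (upper_grid k x) \<le> x + inverse (real (Suc k))"
proof -
  have "real_of_rat (upper_grid k x) \<le> (x * real (Suc k) + 1) / real (Suc k)"
    unfolding of_rat_upper_grid by (intro divide_right_mono add_right_mono of_int_floor_le) simp
  then show ?thesis by (simp add: add_divide_distrib inverse_eq_divide)
qed

lemma upper_grid_mono: "x \<le> y \<Longrightarrow> upper_grid k x \<le> upper_grid k y"
  unfolding upper_grid_def
  by (intro divide_right_mono add_right_mono of_int_le_iff[THEN iffD2] floor_mono mult_right_mono)
    auto

lemma measurable_upper_grid [measurable]: "upper_grid k \<in> borel \<rightarrow>\<^sub>M count_space UNIV"
proof -
  have "(\<lambda>x. (\<lambda>i :: int. (of_int i + 1 :: rat) / of_nat (Suc k)) \<lfloor>x * real (Suc k)\<rfloor>)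
      \<in> borel \<rightarrow>\<^sub>M count_space UNIV"
    by measurable
  then show ?thesis by (simp add: upper_grid_def[abs_def])
qed

lemma filterlim_upper_grid_at_right:
  "filterlim (\<lambda>k. real_of_rat (upper_grid k x)) (at_right x) sequentially"
proof -
  have "(\<lambda>k. real_of_rat (upper_grid k x)) \<longlonglongrightarrow> x"
  proof (rule tendsto_sandwich[where f="\<lambda>_. x"])
    show "(\<lambda>k. x + inverse (real (Suc k))) \<longlonglongrightarrow> x"
      using tendsto_add[OF tendsto_const LIMSEQ_inverse_real_of_nat, of x] by simp
  qed (auto simp del: of_nat_Suc
      intro!: always_eventually less_imp_le[OF upper_grid_greater] upper_grid_le)
  then show ?thesis
    using upper_grid_greater[of x] by (auto simp: filterlim_at less_imp_neq[THEN not_sym])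
qed

lemma borel_measurable_right_continuous_process:
  fixes X :: "real \<Rightarrow> 'a \<Rightarrow> real"
  assumes meas: "\<And>t. 0 \<le> t \<Longrightarrow> X t \<in> borel_measurable M"
    and cont: "\<And>\<omega> t. \<omega> \<in> space M \<Longrightarrow> 0 \<le> t \<Longrightarrow> continuous (at_right t) (\<lambda>t. X t \<omega>)"
  shows "(\<lambda>(\<omega>, t). X t \<omega>) \<in> borel_measurable (M \<Otimes>\<^sub>M restrict_space borel {0..})"
proof (rule borel_measurable_LIMSEQ_real)
  let ?N = "M \<Otimes>\<^sub>M restrict_space borel {0..}"
  fix k
  have [measurable]: "snd \<in> borel_measurable ?N"
    by (rule measurable_compose[OF measurable_snd]) (simp add: measurable_restrict_space1)
  show "(\<lambda>p. X (max 0 (real_of_rat (upper_grid k (snd p)))) (fst p)) \<in> borel_measurable ?N"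
  proof (rule measurable_compose_countable)
    show "(\<lambda>p. X (max 0 (real_of_rat q)) (fst p)) \<in> borel_measurable ?N" for q
      by (rule measurable_compose[OF measurable_fst meas]) simp
  qed measurable
next
  fix p :: "'a \<times> real" assume "p \<in> space (M \<Otimes>\<^sub>M restrict_space borel {0..})"
  then have p: "fst p \<in> space M" "0 \<le> snd p" by (auto simp: space_pair_measure space_restrict_space)
  then have "((\<lambda>t. X t (fst p)) \<longlongrightarrow> X (snd p) (fst p)) (at_right (snd p))"
    using cont by (simp add: continuous_within)
  from filterlim_compose[OF this filterlim_upper_grid_at_right]
  have "(\<lambda>k. X (real_of_rat (upper_grid k (snd p))) (fst p)) \<longlonglongrightarrow> X (snd p) (fst p)" .
  moreover have "max 0 (real_of_rat (upper_grid k (snd p))) = real_of_rat (upper_grid k (snd p))"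
    for k
    using upper_grid_greater[of "snd p" k] p(2) by simp
  ultimately show "(\<lambda>k. X (max 0 (real_of_rat (upper_grid k (snd p)))) (fst p))
      \<longlonglongrightarrow> (case p of (\<omega>, t) \<Rightarrow> X t \<omega>)"
    by (simp add: split_beta)
qed

definition rational_upward_sum :: "(real \<Rightarrow> real) \<Rightarrow> real \<Rightarrow> rat list \<Rightarrow> real" where
  "rational_upward_sum f t qs =
     upward_sum f (length qs - 1) (\<lambda>i. min t (real_of_rat (qs ! i)))"

context cadlag_bv_path
begin

lemma rational_upward_sum_le:
  assumes "sorted qs"
  shows "rational_upward_sum f t qs \<le> pos_variation f t"
proof -
  have "(length qs - 1, \<lambda>i. min t (real_of_rat (qs ! i))) \<in> partitions_upto t"
    using sorted_nth_mono[OF assms]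
    by (auto simp: partitions_upto_def of_rat_less_eq min.coboundedI2)
  from upward_sum_le_pos_variation[OF bounded_variation this]
  show ?thesis by (simp add: rational_upward_sum_def)
qed

lemma bdd_above_rational_upward_sum:
  "bdd_above (rational_upward_sum f t ` {qs. sorted qs})"
  by (rule bdd_aboveI[of _ "pos_variation f t"]) (auto intro: rational_upward_sum_le)

lemma ext0_upper_grid_tendsto:
  assumes "x \<le> t"
  shows "(\<lambda>k. ext0 f (min t (real_of_rat (upper_grid k x)))) \<longlonglongrightarrow> ext0 f x"
proof (cases "x = t")
  case True
  then have "min t (real_of_rat (upper_grid k x)) = x" for k
    using upper_grid_greater[of x k] by simp
  then show ?thesis by simp
next
  case False
  then have "x < t" using assms by simp
  have "(\<lambda>k. real_of_rat (upper_grid k x)) \<longlonglongrightarrow> x"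
    using filterlim_upper_grid_at_right[of x] by (simp add: filterlim_at)
  from order_tendstoD(2)[OF this \<open>x < t\<close>]
  have "\<forall>\<^sub>F k in sequentially.
      ext0 f (real_of_rat (upper_grid k x)) = ext0 f (min t (real_of_rat (upper_grid k x)))"
    by eventually_elim simp
  with filterlim_compose[OF ext0_tendsto_at_right filterlim_upper_grid_at_right]
  show ?thesis by (rule Lim_transform_eventually)
qed

lemma rational_upward_sum_tendsto:
  assumes np: "(n, p) \<in> partitions_upto t"
  shows "(\<lambda>k. rational_upward_sum f t (map (\<lambda>i. upper_grid k (p i)) [0..<Suc n]))
    \<longlonglongrightarrow> upward_sum f n p"
proof -
  have "rational_upward_sum f t (map (\<lambda>i. upper_grid k (p i)) [0..<Suc n]) =
      (\<Sum>i<n. max 0 (ext0 f (min t (real_of_rat (upper_grid k (p (Suc i)))))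
        - ext0 f (min t (real_of_rat (upper_grid k (p i))))))" for k
    by (auto simp: rational_upward_sum_def upward_sum_def simp del: upt_Suc intro!: sum.cong)
  moreover have "(\<lambda>k. \<Sum>i<n. max 0 (ext0 f (min t (real_of_rat (upper_grid k (p (Suc i)))))
        - ext0 f (min t (real_of_rat (upper_grid k (p i)))))) \<longlonglongrightarrow> upward_sum f n p"
    unfolding upward_sum_def
    by (intro tendsto_sum tendsto_max tendsto_diff tendsto_const ext0_upper_grid_tendsto)
      (auto intro: partition_le[OF np])
  ultimately show ?thesis by simp
qed

lemma pos_variation_eq_rational_SUP:
  "pos_variation f t = (SUP qs\<in>{qs. sorted qs}. rational_upward_sum f t qs)"
proof (rule antisym)
  show "(SUP qs\<in>{qs. sorted qs}. rational_upward_sum f t qs) \<le> pos_variation f t"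
    by (rule cSUP_least) (auto intro: rational_upward_sum_le exI[of _ "[]"])
  show "pos_variation f t \<le> (SUP qs\<in>{qs. sorted qs}. rational_upward_sum f t qs)"
  proof (rule pos_variation_least)
    fix n p assume np: "(n, p) \<in> partitions_upto t"
    have "sorted (map (\<lambda>i. upper_grid k (p i)) [0..<Suc n])" for k
      by (auto simp: sorted_iff_nth_mono simp del: upt_Suc
          intro!: upper_grid_mono partition_mono[OF np])
    then have "rational_upward_sum f t (map (\<lambda>i. upper_grid k (p i)) [0..<Suc n])
        \<le> (SUP qs\<in>{qs. sorted qs}. rational_upward_sum f t qs)" for k
      by (intro cSUP_upper bdd_above_rational_upward_sum) simp
    then show "upward_sum f n p \<le> (SUP qs\<in>{qs. sorted qs}. rational_upward_sum f t qs)"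
      by (intro LIMSEQ_le_const2[OF rational_upward_sum_tendsto[OF np]]) blast
  qed
qed

end

lemma borel_measurable_pos_variation:
  assumes meas: "\<And>s. 0 \<le> s \<Longrightarrow> s \<le> t \<Longrightarrow> I s \<in> borel_measurable N"
    and path: "\<And>\<omega>. \<omega> \<in> space N \<Longrightarrow> cadlag_bv_path (\<lambda>t. I t \<omega>)"
  shows "(\<lambda>\<omega>. pos_variation (\<lambda>t. I t \<omega>) t) \<in> borel_measurable N"
proof -
  have [measurable]: "(\<lambda>\<omega>. ext0 (\<lambda>t. I t \<omega>) (min t s)) \<in> borel_measurable N" for s
    using meas[of "min t s"] by (cases "min t s < 0") (auto simp: ext0_def)
  have "(\<lambda>\<omega>. SUP qs\<in>{qs. sorted qs}. rational_upward_sum (\<lambda>t. I t \<omega>) t qs) \<in> borel_measurable N"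
  proof (rule borel_measurable_cSUP)
    show "(\<lambda>\<omega>. rational_upward_sum (\<lambda>t. I t \<omega>) t qs) \<in> borel_measurable N" for qs
      unfolding rational_upward_sum_def upward_sum_def by measurable
  qed (auto intro: cadlag_bv_path.bdd_above_rational_upward_sum path)
  then show ?thesis
    by (rule measurable_cong[THEN iffD2, rotated])
      (rule cadlag_bv_path.pos_variation_eq_rational_SUP[OF path])
qed

lemma first_positive_time_le: "0 \<le> t \<Longrightarrow> 0 < f t \<Longrightarrow> first_positive_time f \<le> ennreal t"
  unfolding first_positive_time_def by (rule Inf_lower) auto

lemma first_positive_time_less_iff:
  "first_positive_time f < u \<longleftrightarrow> (\<exists>t\<ge>0. ennreal t < u \<and> 0 < f t)"
  by (auto simp: first_positive_time_def Inf_less_iff)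

lemma first_positive_time_less_iff_rational:
  assumes mono: "mono_on {0..} f"
  shows "first_positive_time f < ennreal r \<longleftrightarrow> (\<exists>q\<in>{q\<in>\<rat>. 0 \<le> q \<and> q < r}. 0 < f q)"
proof
  assume "first_positive_time f < ennreal r"
  then obtain t where t: "0 \<le> t" "ennreal t < ennreal r" "0 < f t"
    by (auto simp: first_positive_time_less_iff)
  then obtain q where "q \<in> \<rat>" "t < q" "q < r"
    using Rats_dense_in_real[of t r] by (auto simp: ennreal_less_iff)
  then show "\<exists>q\<in>{q\<in>\<rat>. 0 \<le> q \<and> q < r}. 0 < f q"
    using t mono_onD[OF mono, of t q] by (intro bexI[of _ q]) auto
qed (auto simp: first_positive_time_less_iff ennreal_less_iff)

lemma stopping_time_right_continuousI:
  fixes F :: "ennreal \<Rightarrow> 'a measure"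
  assumes "filtration \<Omega> F"
    and right_continuous: "\<And>t. t < \<infinity> \<Longrightarrow> sets (F t) = (\<Inter>u\<in>{t<..}. sets (F u))"
    and less: "\<And>r. {\<omega>\<in>\<Omega>. T \<omega> < ennreal r} \<in> sets (F (ennreal r))"
  shows "stopping_time F T"
proof
  interpret filtration \<Omega> F by fact
  fix t
  show "Measurable.pred (F t) (\<lambda>\<omega>. T \<omega> \<le> t)"
  proof (cases "t = \<infinity>")
    case False
    have "{\<omega>\<in>\<Omega>. T \<omega> \<le> t} \<in> sets (F u)" if "t < u" for u
    proof -
      let ?R = "{q :: rat. t < ennreal (real_of_rat q) \<and> ennreal (real_of_rat q) < u}"
      have "\<exists>q\<in>?R. ennreal (real_of_rat q) \<le> T \<omega>" if "t < T \<omega>" for \<omega>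
        using ennreal_rat_dense[of t "min (T \<omega>) u"] that \<open>t < u\<close> by (auto intro: less_imp_le)
      then have "{\<omega>\<in>\<Omega>. T \<omega> \<le> t} = (\<Inter>q\<in>?R. {\<omega>\<in>\<Omega>. T \<omega> < ennreal (real_of_rat q)})"
        using ennreal_rat_dense[OF \<open>t < u\<close>] by (force simp: not_le[symmetric])
      moreover have "{\<omega>\<in>\<Omega>. T \<omega> < ennreal (real_of_rat q)} \<in> sets (F u)" if "q \<in> ?R" for q
        using less[of "real_of_rat q"] sets_F_mono[of "ennreal (real_of_rat q)" u] that
        by (auto intro: less_imp_le)
      ultimately show ?thesis
        using ennreal_rat_dense[OF \<open>t < u\<close>] by (auto intro!: sets.countable_INT'')
    qed
    then show ?thesis
      using right_continuous[of t] False by (auto simp: pred_def space_F less_top)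
  qed simp
qed

lemma stopping_time_first_positive_time:
  fixes F :: "ennreal \<Rightarrow> 'a measure" and V :: "real \<Rightarrow> 'a \<Rightarrow> real"
  assumes filtration: "filtration \<Omega> F"
    and right_continuous: "\<And>t. t < \<infinity> \<Longrightarrow> sets (F t) = (\<Inter>u\<in>{t<..}. sets (F u))"
    and adapted: "adapted F V"
    and mono: "\<And>\<omega>. \<omega> \<in> \<Omega> \<Longrightarrow> mono_on {0..} (\<lambda>t. V t \<omega>)"
  shows "stopping_time F (\<lambda>\<omega>. first_positive_time (\<lambda>t. V t \<omega>))"
proof (rule stopping_time_right_continuousI[OF filtration right_continuous])
  interpret filtration \<Omega> F by (rule filtration)
  fix r
  have "{\<omega>\<in>\<Omega>. 0 < V q \<omega>} \<in> sets (F (ennreal r))" if "0 \<le> q" "q < r" for q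
  proof -
    have [measurable]: "V q \<in> borel_measurable (F (ennreal q))"
      using adapted \<open>0 \<le> q\<close> by (simp add: adapted_def)
    have "{\<omega>\<in>space (F (ennreal q)). 0 < V q \<omega>} \<in> sets (F (ennreal q))" by measurable
    then show ?thesis
      using sets_F_mono[of "ennreal q" "ennreal r"] that by (auto simp: space_F ennreal_leI)
  qed
  then have "(\<Union>q\<in>{q\<in>\<rat>. 0 \<le> q \<and> q < r}. {\<omega>\<in>\<Omega>. 0 < V q \<omega>}) \<in> sets (F (ennreal r))"
    by (intro sets.countable_UN'' countable_subset[OF _ countable_rat]) auto
  also have "(\<Union>q\<in>{q\<in>\<rat>. 0 \<le> q \<and> q < r}. {\<omega>\<in>\<Omega>. 0 < V q \<omega>}) =
      {\<omega>\<in>\<Omega>. first_positive_time (\<lambda>t. V t \<omega>) < ennreal r}"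
    using first_positive_time_less_iff_rational[OF mono] by auto
  finally show "{\<omega>\<in>\<Omega>. first_positive_time (\<lambda>t. V t \<omega>) < ennreal r} \<in> sets (F (ennreal r))" .
qed

section \<open>Discounted Lebesgue measure\<close>

definition disc_lborel :: "real \<Rightarrow> real measure" where
  "disc_lborel \<rho> = density (restrict_space lborel {0..}) (\<lambda>t. ennreal (exp (- \<rho> * t)))"

lemma sets_disc_lborel [measurable_cong, simp]:
  "sets (disc_lborel \<rho>) = sets (restrict_space borel {0..})"
  by (simp add: disc_lborel_def cong: sets_restrict_space_cong)

lemma space_disc_lborel [simp]: "space (disc_lborel \<rho>) = {0..}"
  by (simp add: disc_lborel_def space_restrict_space)

lemma measurable_disc_lborel: "f \<in> disc_lborel \<rho> \<rightarrow>\<^sub>M N \<longleftrightarrow> f \<in> restrict_space lborel {0..} \<rightarrow>\<^sub>M N"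
  by (simp add: disc_lborel_def)

lemma borel_measurable_time [measurable]: "(\<lambda>t. t) \<in> borel_measurable (disc_lborel \<rho>)"
  by (simp add: measurable_disc_lborel measurable_restrict_space1)

lemma nn_integral_disc_lborel:
  assumes "f \<in> borel_measurable (disc_lborel \<rho>)"
  shows "(\<integral>\<^sup>+t. f t \<partial>disc_lborel \<rho>) = (\<integral>\<^sup>+t\<in>{0..}. ennreal (exp (- \<rho> * t)) * f t \<partial>lborel)"
proof -
  have "(\<integral>\<^sup>+t. f t \<partial>disc_lborel \<rho>) =
      (\<integral>\<^sup>+t. ennreal (exp (- \<rho> * t)) * f t \<partial>restrict_space lborel {0..})"
    unfolding disc_lborel_def
    by (rule nn_integral_density)
      (use assms in \<open>simp_all add: measurable_disc_lborel measurable_restrict_space1\<close>)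
  then show ?thesis by (simp add: nn_integral_restrict_space)
qed

lemma integral_disc_lborel:
  fixes f :: "real \<Rightarrow> real"
  assumes "f \<in> borel_measurable (disc_lborel \<rho>)"
  shows "(LINT t|disc_lborel \<rho>. f t) = (LINT t:{0..}|lborel. exp (- \<rho> * t) * f t)"
proof -
  have "(LINT t|disc_lborel \<rho>. f t) = (LINT t|restrict_space lborel {0..}. exp (- \<rho> * t) *\<^sub>R f t)"
    unfolding disc_lborel_def
    by (rule integral_density)
      (use assms in \<open>simp_all add: measurable_disc_lborel measurable_restrict_space1\<close>)
  then show ?thesis by (simp add: integral_restrict_space set_lebesgue_integral_def)
qed

lemma emeasure_disc_lborel_atLeast:
  assumes "0 < \<rho>" "0 \<le> s"
  shows "emeasure (disc_lborel \<rho>) {s..} = ennreal (exp (- \<rho> * s) / \<rho>)"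
proof -
  have "{s..} \<in> sets (disc_lborel \<rho>)"
    using assms(2) by (simp add: sets_restrict_space_iff)
  then have "emeasure (disc_lborel \<rho>) {s..} = (\<integral>\<^sup>+t. indicator {s..} t \<partial>disc_lborel \<rho>)" by simp
  also have "\<dots> = (\<integral>\<^sup>+t. ennreal (exp (- \<rho> * t)) * indicator {s..} t \<partial>lborel)"
    by (subst nn_integral_disc_lborel)
      (use assms(2) in \<open>auto intro!: nn_integral_cong simp: indicator_def\<close>)
  also have "\<dots> = ennreal (0 - (- exp (- \<rho> * s) / \<rho>))"
  proof (rule nn_integral_FTC_atLeast)
    show "DERIV (\<lambda>t. - exp (- \<rho> * t) / \<rho>) x :> exp (- \<rho> * x)" for x
      using assms by (auto intro!: derivative_eq_intros)
    have "((\<lambda>t. exp (- \<rho> * t)) \<longlongrightarrow> 0) at_top"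
      using assms by (auto simp: filterlim_uminus_at_bot intro!: filterlim_compose[OF exp_at_bot]
          filterlim_tendsto_pos_mult_at_top[OF tendsto_const] filterlim_ident)
    from tendsto_divide[OF tendsto_minus[OF this] tendsto_const, of \<rho>]
    show "((\<lambda>t. - exp (- \<rho> * t) / \<rho>) \<longlongrightarrow> 0) at_top" using assms by simp
  qed auto
  finally show ?thesis by simp
qed

lemma finite_measure_disc_lborel: "0 < \<rho> \<Longrightarrow> finite_measure (disc_lborel \<rho>)"
  using emeasure_disc_lborel_atLeast[of \<rho> 0] by (intro finite_measureI) simp

lemma AE_disc_lborel_neq: "AE t in disc_lborel \<rho>. t \<noteq> x"
proof -
  have "AE t in restrict_space lborel {0..}. t \<noteq> x"
    using AE_lborel_singleton[of x] by (simp add: AE_restrict_space_iff eventually_mono)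
  then show ?thesis
    unfolding disc_lborel_def by (subst AE_density) (simp_all add: measurable_restrict_space1)
qed

lemma integral_disc_lborel_stop:
  assumes "0 < \<rho>"
  shows "(LINT t|disc_lborel \<rho>. (if a \<le> ennreal t then k else 0)) = k * discount \<rho> a / \<rho>"
proof (cases a)
  case top
  then show ?thesis by (simp add: discount_def top_unique)
next
  case (real s)
  have "(LINT t|disc_lborel \<rho>. (if a \<le> ennreal t then k else 0)) =
      (LINT t|disc_lborel \<rho>. k * indicator {s..} t)"
    by (rule Bochner_Integration.integral_cong) (use real in auto)
  also have "\<dots> = k * measure (disc_lborel \<rho>) {s..}"
    using real by (simp add: Int_absorb2)
  also have "\<dots> = k * discount \<rho> a / \<rho>"
    using real assms by (simp add: measure_def emeasure_disc_lborel_atLeast discount_def)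
  finally show ?thesis .
qed

lemma emeasure_interval_measure_ext0_Icc:
  assumes H: "increasing_path H" and "0 \<le> t"
  shows "emeasure (interval_measure (ext0 H)) {0..t} = ennreal (H t)"
proof -
  let ?V = "interval_measure (ext0 H)" and ?A = "\<lambda>n. {- inverse (real (Suc n))<..t}"
  have Ioc: "emeasure ?V {a<..b} = ennreal (ext0 H b - ext0 H a)" if "a \<le> b" for a b
    by (rule emeasure_interval_measure_Ioc[OF that])
      (auto intro: monoD[OF mono_ext0_increasing_path[OF H]]
          continuous_at_right_ext0_increasing_path[OF H])
  have A: "emeasure ?V (?A n) = ennreal (H t)" for n
    using \<open>0 \<le> t\<close> by (subst Ioc) (auto simp: ext0_def intro: order_trans[of _ 0])
  have "(INF n. emeasure ?V (?A n)) = emeasure ?V (\<Inter>n. ?A n)"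
    proof (rule INF_emeasure_decseq)
    have "?A n \<subseteq> ?A m" if "m \<le> n" for m n
    proof -
      have "inverse (real (Suc n)) \<le> inverse (real (Suc m))"
        using that by (intro le_imp_inverse_le) auto
      then show ?thesis by (simp only: Ioc_subset_iff) simp
    qed
    then show "decseq ?A" by (auto simp only: decseq_def)
    show "emeasure ?V (?A n) \<noteq> \<infinity>" for n unfolding A by simp
  qed auto
  moreover have "(\<Inter>n. ?A n) = {0..t}"
  proof (intro set_eqI iffI)
    fix x assume x: "x \<in> (\<Inter>n. ?A n)"
    have "\<not> x < 0"
    proof
      assume "x < 0"
      then obtain n where "inverse (real (Suc n)) < - x" using reals_Archimedean[of "- x"] by auto
      then show False using x by (auto dest!: spec[of _ n])
    qed
    then show "x \<in> {0..t}" using x by auto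
  qed (auto intro: less_le_trans[of _ 0])
  ultimately show ?thesis by (simp add: A del: of_nat_Suc)
qed

lemma discount_eq_nn_integral:
  assumes \<rho>: "0 < \<rho>"
  shows "ennreal (exp (- \<rho> * s)) * indicator {0..} s =
    (\<integral>\<^sup>+t. ennreal \<rho> * indicator {0..t} s \<partial>disc_lborel \<rho>)"
proof (cases "0 \<le> s")
  case True
  have "(\<integral>\<^sup>+t. ennreal \<rho> * indicator {0..t} s \<partial>disc_lborel \<rho>) =
      (\<integral>\<^sup>+t. ennreal \<rho> * indicator {s..} t \<partial>disc_lborel \<rho>)"
    using True by (intro nn_integral_cong) (auto simp: indicator_def)
  also have "\<dots> = ennreal \<rho> * emeasure (disc_lborel \<rho>) {s..}"
    using True by (intro nn_integral_cmult_indicator) (simp add: sets_restrict_space_iff)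
  finally show ?thesis
    using True \<rho> by (simp add: emeasure_disc_lborel_atLeast ennreal_mult'[symmetric])
qed simp

text \<open>Integration by parts, in the form of Tonelli's theorem on \<open>{(s, t). 0 \<le> s \<le> t}\<close>.\<close>

lemma nn_integral_exp_interval_measure:
  assumes \<rho>: "0 < \<rho>" and H: "increasing_path H"
  shows "(\<integral>\<^sup>+t\<in>{0..}. ennreal (exp (- \<rho> * t)) \<partial>interval_measure (ext0 H)) =
    (\<integral>\<^sup>+t. ennreal (\<rho> * H t) \<partial>disc_lborel \<rho>)"
proof -
  let ?V = "interval_measure (ext0 H)"
  interpret V: sigma_finite_measure ?V
    by (rule sigma_finite_interval_measure)
      (auto intro: monoD[OF mono_ext0_increasing_path[OF H]]
          continuous_at_right_ext0_increasing_path[OF H])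
  interpret L: finite_measure "disc_lborel \<rho>" using \<rho> by (rule finite_measure_disc_lborel)
  interpret pair_sigma_finite ?V "disc_lborel \<rho>" ..
  have "(\<integral>\<^sup>+t\<in>{0..}. ennreal (exp (- \<rho> * t)) \<partial>?V) =
      (\<integral>\<^sup>+s. (\<integral>\<^sup>+t. ennreal \<rho> * indicator {0..t} s \<partial>disc_lborel \<rho>) \<partial>?V)"
    by (simp only: discount_eq_nn_integral[OF \<rho>])
  also have "\<dots> = (\<integral>\<^sup>+t. (\<integral>\<^sup>+s. ennreal \<rho> * indicator {0..t} s \<partial>?V) \<partial>disc_lborel \<rho>)"
  proof (rule Fubini'[symmetric])
    have "(\<lambda>p. ennreal \<rho> * indicator {p. 0 \<le> fst p \<and> fst p \<le> snd p} p)
        \<in> borel_measurable (?V \<Otimes>\<^sub>M disc_lborel \<rho>)" by measurable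
    then show "(\<lambda>(s, t). ennreal \<rho> * indicator {0..t} s) \<in> borel_measurable (?V \<Otimes>\<^sub>M disc_lborel \<rho>)"
      by (simp add: split_beta' indicator_def)
  qed
  also have "\<dots> = (\<integral>\<^sup>+t. ennreal (\<rho> * H t) \<partial>disc_lborel \<rho>)"
    using \<rho> by (intro nn_integral_cong)
      (simp add: nn_integral_cmult_indicator emeasure_interval_measure_ext0_Icc[OF H] ennreal_mult')
  finally show ?thesis .
qed

section \<open>The control problem for a fixed demand process\<close>

definition purchases :: "(real \<Rightarrow> 'a \<Rightarrow> real) \<Rightarrow> real \<Rightarrow> 'a \<Rightarrow> real" where
  "purchases I t \<omega> = pos_variation (\<lambda>s. I s \<omega>) t"

definition sales :: "(real \<Rightarrow> 'a \<Rightarrow> real) \<Rightarrow> real \<Rightarrow> 'a \<Rightarrow> real" where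
  "sales I t \<omega> = neg_variation (\<lambda>s. I s \<omega>) t"

definition purchase_time :: "(real \<Rightarrow> 'a \<Rightarrow> real) \<Rightarrow> 'a \<Rightarrow> ennreal" where
  "purchase_time I \<omega> = first_positive_time (pos_variation (\<lambda>s. I s \<omega>))"

definition sale_time :: "(real \<Rightarrow> 'a \<Rightarrow> real) \<Rightarrow> 'a \<Rightarrow> ennreal" where
  "sale_time I \<omega> = first_positive_time (neg_variation (\<lambda>s. I s \<omega>))"

definition stopped_first :: "('a \<Rightarrow> ennreal) \<Rightarrow> ('a \<Rightarrow> ennreal) \<Rightarrow> 'a \<Rightarrow> real \<Rightarrow> real" where
  "stopped_first \<sigma> \<tau> \<omega> t = (if \<sigma> \<omega> < \<tau> \<omega> \<and> \<sigma> \<omega> \<le> ennreal t then 1 else 0)"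

lemma stopped_first_nonneg: "0 \<le> stopped_first \<sigma> \<tau> \<omega> t"
  by (simp add: stopped_first_def)

lemma purchases_uminus: "purchases (\<lambda>t \<omega>. - I t \<omega>) = sales I"
  by (simp add: purchases_def sales_def fun_eq_iff)

lemma purchase_time_uminus: "purchase_time (\<lambda>t \<omega>. - I t \<omega>) = sale_time I"
  by (simp add: purchase_time_def sale_time_def fun_eq_iff)

lemma purchase_time_altdef: "purchase_time I \<omega> = first_positive_time (\<lambda>t. purchases I t \<omega>)"
  by (simp add: purchase_time_def purchases_def)

locale state_process = prob_space M + filtration "space M" F
  for M :: "'a measure" and F :: "ennreal \<Rightarrow> 'a measure" +
  fixes X :: "real \<Rightarrow> 'a \<Rightarrow> real" and U :: "real set"
  assumes F_sub: "\<And>t. sets (F t) \<subseteq> sets M"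
    and X_adapted: "adapted F X"
    and X_cont: "\<And>\<omega>. \<omega> \<in> space M \<Longrightarrow> continuous_on {0..} (\<lambda>t. X t \<omega>)"
    and X_in: "\<And>\<omega> t. \<omega> \<in> space M \<Longrightarrow> 0 \<le> t \<Longrightarrow> X t \<omega> \<in> U"
    and open_U: "open U"
begin

lemma measurable_F_M: "h \<in> borel_measurable (F t) \<Longrightarrow> h \<in> borel_measurable M"
  by (rule measurable_mono[THEN subsetD, OF order_refl refl F_sub space_F])

lemma adapted_measurable: "adapted F V \<Longrightarrow> 0 \<le> t \<Longrightarrow> V t \<in> borel_measurable M"
  by (auto simp: adapted_def intro: measurable_F_M)

lemma measurable_adapted_right_continuous:
  assumes "adapted F V"
    and "\<And>\<omega> t. \<omega> \<in> space M \<Longrightarrow> 0 \<le> t \<Longrightarrow> continuous (at_right t) (\<lambda>t. V t \<omega>)"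
  shows "(\<lambda>p. V (snd p) (fst p)) \<in> borel_measurable (M \<Otimes>\<^sub>M disc_lborel \<rho>)"
proof -
  have "(\<lambda>(\<omega>, t). V t \<omega>) \<in> borel_measurable (M \<Otimes>\<^sub>M restrict_space borel {0..})"
    using adapted_measurable[OF assms(1)] assms(2)
    by (rule borel_measurable_right_continuous_process)
  moreover have "borel_measurable (M \<Otimes>\<^sub>M disc_lborel \<rho>) =
      borel_measurable (M \<Otimes>\<^sub>M restrict_space borel {0..})"
    by (intro measurable_cong_sets sets_pair_measure_cong) simp_all
  ultimately show ?thesis by (simp add: split_beta')
qed

lemma measurable_X [measurable]: "(\<lambda>p. X (snd p) (fst p)) \<in> borel_measurable (M \<Otimes>\<^sub>M disc_lborel \<rho>)"
proof (rule measurable_adapted_right_continuous[OF X_adapted])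
  show "continuous (at_right t) (\<lambda>t. X t \<omega>)" if "\<omega> \<in> space M" "0 \<le> t" for \<omega> t
    using X_cont[OF that(1)] that(2)
    by (auto simp: continuous_on_eq_continuous_within intro: continuous_within_subset)
qed

lemma borel_measurable_continuous_on_X:
  fixes h :: "real \<Rightarrow> real \<Rightarrow> real"
  assumes h: "continuous_on (UNIV \<times> U) (\<lambda>(c, d). h c d)"
    and [measurable]: "a \<in> borel_measurable (M \<Otimes>\<^sub>M disc_lborel \<rho>)"
  shows "(\<lambda>p. h (a p) (X (snd p) (fst p))) \<in> borel_measurable (M \<Otimes>\<^sub>M disc_lborel \<rho>)"
proof -
  have "open (UNIV \<times> U :: (real \<times> real) set)" using open_U by (intro open_Times) auto
  then have "(\<lambda>z. indicator (UNIV \<times> U) z *\<^sub>R (case z of (c, d) \<Rightarrow> h c d)) \<in> borel_measurable borel"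
    by (intro borel_measurable_continuous_on_indicator h) simp
  then have "(\<lambda>p. indicator (UNIV \<times> U) (a p, X (snd p) (fst p)) *\<^sub>R
      (case (a p, X (snd p) (fst p)) of (c, d) \<Rightarrow> h c d)) \<in> borel_measurable (M \<Otimes>\<^sub>M disc_lborel \<rho>)"
    by (rule measurable_compose[rotated]) measurable
  then show ?thesis
    by (rule measurable_cong[THEN iffD1, rotated]) (auto simp: space_pair_measure X_in)
qed

end

locale control_problem = state_process M F X U
  for M :: "'a measure" and F :: "ennreal \<Rightarrow> 'a measure" and X :: "real \<Rightarrow> 'a \<Rightarrow> real" and U +
  fixes g gc :: "real \<Rightarrow> real \<Rightarrow> real" and \<rho> qp qm :: real
  assumes F_right: "\<And>t. t < \<infinity> \<Longrightarrow> sets (F t) = (\<Inter>u\<in>{t<..}. sets (F u))"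
    and g_nonneg: "\<And>c d. d \<in> U \<Longrightarrow> 0 \<le> g c d"
    and g_cont: "continuous_on (UNIV \<times> U) (\<lambda>(c, d). g c d)"
    and g_convex: "\<And>d. d \<in> U \<Longrightarrow> convex_on UNIV (\<lambda>c. g c d)"
    and g_deriv: "\<And>c d. d \<in> U \<Longrightarrow> ((\<lambda>x. g x d) has_real_derivative gc c d) (at c)"
    and gc_cont: "continuous_on (UNIV \<times> U) (\<lambda>(c, d). gc c d)"
    and g_integrable: "\<And>c. integrable (M \<Otimes>\<^sub>M disc_lborel \<rho>) (\<lambda>(\<omega>, t). g c (X t \<omega>))"
    and gc_integrable: "\<And>c. integrable (M \<Otimes>\<^sub>M disc_lborel \<rho>) (\<lambda>(\<omega>, t). gc c (X t \<omega>))"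
    and \<rho>_pos: "0 < \<rho>" and qp_pos: "0 < qp" and qm_pos: "0 < qm"
begin

abbreviation Q :: "('a \<times> real) measure" where
  "Q \<equiv> M \<Otimes>\<^sub>M disc_lborel \<rho>"

abbreviation cost :: "real \<Rightarrow> (real \<Rightarrow> 'a \<Rightarrow> real) \<Rightarrow> ennreal" where
  "cost \<equiv> total_cost M \<rho> qp qm g X"

abbreviation payoff :: "real \<Rightarrow> ('a \<Rightarrow> ennreal) \<Rightarrow> ('a \<Rightarrow> ennreal) \<Rightarrow> real" where
  "payoff \<equiv> dynkin_payoff M \<rho> qp qm gc X"

definition optimal_cost :: "real \<Rightarrow> ennreal" where
  "optimal_cost c = (INF I\<in>controls M F. cost c I)"

abbreviation v :: "real \<Rightarrow> real" where
  "v c \<equiv> enn2real (optimal_cost c)"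

sublocale L: finite_measure "disc_lborel \<rho>"
  by (rule finite_measure_disc_lborel[OF \<rho>_pos])

sublocale MxL: pair_sigma_finite M "disc_lborel \<rho>" ..

sublocale Q: finite_measure Q
  by (rule finite_measure_pair_measure) unfold_locales

lemma tangent_le: "d \<in> U \<Longrightarrow> gc x d * (y - x) \<le> g y d - g x d"
  using convex_on_imp_above_tangent[OF g_convex, of d x y "gc x d"] g_deriv[of d x] by simp

lemma gc_mono:
  assumes "d \<in> U" "x \<le> y"
  shows "gc x d \<le> gc y d"
proof (cases "x = y")
  case False
  then have "0 < y - x" using assms(2) by simp
  moreover have "gc x d * (y - x) \<le> gc y d * (y - x)"
    using tangent_le[OF assms(1), of x y] tangent_le[OF assms(1), of y x]
    by (simp add: algebra_simps)
  ultimately show ?thesis by (simp add: mult_le_cancel_right)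
qed simp

lemma control_path: "I \<in> controls M F \<Longrightarrow> \<omega> \<in> space M \<Longrightarrow> cadlag_bv_path (\<lambda>t. I t \<omega>)"
  by unfold_locales (auto simp: controls_def)

lemma controlsI:
  assumes "adapted F I" and "\<And>\<omega>. \<omega> \<in> space M \<Longrightarrow> cadlag_bv_path (\<lambda>t. I t \<omega>)"
  shows "I \<in> controls M F"
  using assms(1) cadlag_bv_path.cadlag[OF assms(2)]
    bv_path.bv[OF cadlag_bv_path.axioms(1)[OF assms(2)]]
  by (simp add: controls_def)

lemma controls_adapted: "I \<in> controls M F \<Longrightarrow> adapted F I"
  by (simp add: controls_def)

lemma controls_uminus: "I \<in> controls M F \<Longrightarrow> (\<lambda>t \<omega>. - I t \<omega>) \<in> controls M F"
  using cadlag_bv_path.cadlag_bv_path_uminus[OF control_path] controls_adapted[of I]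
  by (intro controlsI) (auto simp: adapted_def)

lemma increasing_purchases: "I \<in> controls M F \<Longrightarrow> \<omega> \<in> space M \<Longrightarrow> increasing_path (\<lambda>t. purchases I t \<omega>)"
  using cadlag_bv_path.increasing_path_pos_variation[OF control_path] by (simp add: purchases_def)

lemma increasing_sales: "I \<in> controls M F \<Longrightarrow> \<omega> \<in> space M \<Longrightarrow> increasing_path (\<lambda>t. sales I t \<omega>)"
  using cadlag_bv_path.increasing_path_neg_variation[OF control_path] by (simp add: sales_def)

lemmas purchases_nonneg = increasing_path_nonneg[OF increasing_purchases]
lemmas sales_nonneg = increasing_path_nonneg[OF increasing_sales]

lemma control_decomposition:
  "I \<in> controls M F \<Longrightarrow> \<omega> \<in> space M \<Longrightarrow> 0 \<le> t \<Longrightarrow> I t \<omega> = purchases I t \<omega> - sales I t \<omega>"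
  using bv_path.jordan_decomposition[OF cadlag_bv_path.axioms(1)[OF control_path]]
  by (simp add: purchases_def sales_def)

lemma purchases_adapted:
  assumes I: "I \<in> controls M F"
  shows "adapted F (purchases I)"
  unfolding adapted_def
proof (intro allI impI)
  fix t :: real assume "0 \<le> t"
  have "I s \<in> borel_measurable (F (ennreal t))" if "0 \<le> s" "s \<le> t" for s
  proof -
    have "I s \<in> borel_measurable (F (ennreal s))"
      using controls_adapted[OF I] \<open>0 \<le> s\<close> by (simp add: adapted_def)
    then show ?thesis
      by (rule measurable_mono[THEN subsetD, OF order_refl refl, rotated -1])
        (use that sets_F_mono in \<open>simp_all add: space_F ennreal_leI\<close>)
  qed
  then show "purchases I t \<in> borel_measurable (F (ennreal t))"
    unfolding purchases_def[abs_def]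
    by (rule borel_measurable_pos_variation) (use control_path[OF I] in \<open>auto simp: space_F\<close>)
qed

lemma stopping_time_purchase_time:
  assumes I: "I \<in> controls M F"
  shows "stopping_time F (purchase_time I)"
proof -
  have "stopping_time F (\<lambda>\<omega>. first_positive_time (\<lambda>t. purchases I t \<omega>))"
    by (rule stopping_time_first_positive_time[OF filtration_axioms F_right])
      (use purchases_adapted[OF I] increasing_purchases[OF I] in \<open>auto simp: increasing_path_def\<close>)
  then show ?thesis by (simp add: purchase_time_altdef[abs_def])
qed

lemma stopping_time_sale_time: "I \<in> controls M F \<Longrightarrow> stopping_time F (sale_time I)"
  using stopping_time_purchase_time[OF controls_uminus] by (simp add: purchase_time_uminus)

lemma measurable_control:
  assumes I: "I \<in> controls M F"
  shows "(\<lambda>p. I (snd p) (fst p)) \<in> borel_measurable Q"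
  by (rule measurable_adapted_right_continuous[OF controls_adapted[OF I]])
    (use cadlag_bv_path.cadlag[OF control_path[OF I]] in \<open>auto simp: cadlag_def\<close>)

lemma measurable_purchases:
  assumes I: "I \<in> controls M F"
  shows "(\<lambda>p. purchases I (snd p) (fst p)) \<in> borel_measurable Q"
  by (rule measurable_adapted_right_continuous[OF purchases_adapted[OF I]])
    (use increasing_purchases[OF I] in \<open>auto simp: increasing_path_def\<close>)

lemma measurable_sales: "I \<in> controls M F \<Longrightarrow> (\<lambda>p. sales I (snd p) (fst p)) \<in> borel_measurable Q"
  using measurable_purchases[OF controls_uminus] by (simp add: purchases_uminus)

subsection \<open>The cost as an integral over time and chance\<close>

definition cost_rate :: "real \<Rightarrow> (real \<Rightarrow> 'a \<Rightarrow> real) \<Rightarrow> 'a \<Rightarrow> real \<Rightarrow> real" where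
  "cost_rate c I \<omega> t =
     g (c + I t \<omega>) (X t \<omega>) + \<rho> * (qp * purchases I t \<omega> + qm * sales I t \<omega>)"

lemma measurable_g_X:
  assumes I: "I \<in> controls M F"
  shows "(\<lambda>p. g (c + I (snd p) (fst p)) (X (snd p) (fst p))) \<in> borel_measurable Q"
  using borel_measurable_continuous_on_X[OF g_cont] measurable_control[OF I] by simp

lemma measurable_cost_rate:
  assumes I: "I \<in> controls M F"
  shows "(\<lambda>(\<omega>, t). cost_rate c I \<omega> t) \<in> borel_measurable Q"
proof -
  note [measurable] = measurable_g_X[OF I] measurable_purchases[OF I] measurable_sales[OF I]
  show ?thesis unfolding cost_rate_def split_beta' by measurable
qed

lemma cost_rate_nonneg:
  assumes I: "I \<in> controls M F" and "\<omega> \<in> space M" "0 \<le> t"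
  shows "0 \<le> cost_rate c I \<omega> t"
  unfolding cost_rate_def
  using assms(2,3) \<rho>_pos qp_pos qm_pos purchases_nonneg[OF assms] sales_nonneg[OF assms]
  by (intro add_nonneg_nonneg mult_nonneg_nonneg g_nonneg X_in) auto

lemma discounted_path_cost:
  assumes I: "I \<in> controls M F" and \<omega>: "\<omega> \<in> space M"
  shows "(\<integral>\<^sup>+t\<in>{0..}. ennreal (exp (- \<rho> * t) * g (c + I t \<omega>) (X t \<omega>)) \<partial>lborel)
      + ennreal qp * (\<integral>\<^sup>+t\<in>{0..}. ennreal (exp (- \<rho> * t))
          \<partial>interval_measure (ext0 (pos_variation (\<lambda>t. I t \<omega>))))
      + ennreal qm * (\<integral>\<^sup>+t\<in>{0..}. ennreal (exp (- \<rho> * t))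
          \<partial>interval_measure (ext0 (neg_variation (\<lambda>t. I t \<omega>)))) =
      (\<integral>\<^sup>+t. ennreal (cost_rate c I \<omega> t) \<partial>disc_lborel \<rho>)"
    (is "?holding + ennreal qp * ?buying + ennreal qm * ?selling = _")
proof -
  let ?G = "\<lambda>t. g (c + I t \<omega>) (X t \<omega>)"
  have [measurable]: "?G \<in> borel_measurable (disc_lborel \<rho>)"
    "(\<lambda>t. purchases I t \<omega>) \<in> borel_measurable (disc_lborel \<rho>)"
    "(\<lambda>t. sales I t \<omega>) \<in> borel_measurable (disc_lborel \<rho>)"
    using measurable_Pair2[OF measurable_g_X[OF I] \<omega>]
      measurable_Pair2[OF measurable_purchases[OF I] \<omega>]
      measurable_Pair2[OF measurable_sales[OF I] \<omega>] by simp_all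
  have holding: "?holding = (\<integral>\<^sup>+t. ennreal (?G t) \<partial>disc_lborel \<rho>)"
    by (subst nn_integral_disc_lborel)
      (auto intro!: nn_integral_cong simp: indicator_def ennreal_mult'[symmetric])
  have buying: "?buying = (\<integral>\<^sup>+t. ennreal (\<rho> * purchases I t \<omega>) \<partial>disc_lborel \<rho>)"
    using nn_integral_exp_interval_measure[OF \<rho>_pos increasing_purchases[OF I \<omega>]]
    by (simp add: purchases_def)
  have selling: "?selling = (\<integral>\<^sup>+t. ennreal (\<rho> * sales I t \<omega>) \<partial>disc_lborel \<rho>)"
    using nn_integral_exp_interval_measure[OF \<rho>_pos increasing_sales[OF I \<omega>]]
    by (simp add: sales_def)
  have "ennreal (cost_rate c I \<omega> t) = ennreal (?G t)
      + ennreal qp * ennreal (\<rho> * purchases I t \<omega>) + ennreal qm * ennreal (\<rho> * sales I t \<omega>)"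
    if "0 \<le> t" for t
    using \<rho>_pos qp_pos qm_pos purchases_nonneg[OF I \<omega> that] sales_nonneg[OF I \<omega> that]
      g_nonneg[OF X_in[OF \<omega> that], of "c + I t \<omega>"]
    by (simp add: cost_rate_def ennreal_mult'[symmetric] ennreal_plus[symmetric] algebra_simps
        del: ennreal_plus)
  then have "(\<integral>\<^sup>+t. ennreal (cost_rate c I \<omega> t) \<partial>disc_lborel \<rho>) =
      (\<integral>\<^sup>+t. ennreal (?G t) + ennreal qp * ennreal (\<rho> * purchases I t \<omega>)
        + ennreal qm * ennreal (\<rho> * sales I t \<omega>) \<partial>disc_lborel \<rho>)"
    by (intro nn_integral_cong) simp
  then show ?thesis
    unfolding holding buying selling by (simp add: nn_integral_add nn_integral_cmult)
qed

lemma cost_eq: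
  assumes I: "I \<in> controls M F"
  shows "cost c I = (\<integral>\<^sup>+(\<omega>, t). ennreal (cost_rate c I \<omega> t) \<partial>Q)"
proof -
  have "cost c I = (\<integral>\<^sup>+\<omega>. (\<integral>\<^sup>+t. ennreal (cost_rate c I \<omega> t) \<partial>disc_lborel \<rho>) \<partial>M)"
    unfolding total_cost_def by (intro nn_integral_cong discounted_path_cost[OF I])
  also have "\<dots> = (\<integral>\<^sup>+(\<omega>, t). ennreal (cost_rate c I \<omega> t) \<partial>Q)"
    using measurable_cost_rate[OF I, of c]
    by (subst L.nn_integral_fst[symmetric]) (simp_all add: split_beta')
  finally show ?thesis .
qed

lemma optimal_cost_le: "I \<in> controls M F \<Longrightarrow> optimal_cost c \<le> cost c I"
  unfolding optimal_cost_def by (rule INF_lower)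

lemma optimal_cost_finite: "optimal_cost c < \<infinity>"
proof -
  let ?Z = "\<lambda>(t :: real) (\<omega> :: 'a). 0 :: real"
  have Z: "?Z \<in> controls M F"
    by (intro controlsI cadlag_bv_path_difference[OF increasing_path_zero increasing_path_zero])
      (auto simp: adapted_def)
  have "partitions_upto t \<noteq> {}" for t using trivial_partition by blast
  then have "pos_variation (\<lambda>_. 0) = (\<lambda>_. 0)" "neg_variation (\<lambda>_. 0) = (\<lambda>_. 0)"
    by (simp_all add: fun_eq_iff pos_variation_def neg_variation_def ext0_def split_beta)
  then have "cost c ?Z = (\<integral>\<^sup>+(\<omega>, t). ennreal (g c (X t \<omega>)) \<partial>Q)"
    by (simp add: cost_eq[OF Z] cost_rate_def purchases_def sales_def)
  also have "\<dots> \<le> (\<integral>\<^sup>+p. ennreal (norm (case p of (\<omega>, t) \<Rightarrow> g c (X t \<omega>))) \<partial>Q)"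
    by (intro nn_integral_mono) (auto intro: ennreal_leI)
  also have "\<dots> < \<infinity>" using g_integrable[of c] by (simp add: integrable_iff_bounded)
  finally show ?thesis using optimal_cost_le[OF Z] by (rule le_less_trans[rotated])
qed

lemma ennreal_v: "ennreal (v c) = optimal_cost c"
  using optimal_cost_finite[of c] by simp

lemma v_le_integral:
  assumes I: "I \<in> controls M F" and h: "integrable Q (\<lambda>(\<omega>, t). h \<omega> t)"
    and le: "\<And>\<omega> t. \<omega> \<in> space M \<Longrightarrow> 0 \<le> t \<Longrightarrow> cost_rate c I \<omega> t \<le> h \<omega> t"
  shows "v c \<le> (\<integral>(\<omega>, t). h \<omega> t \<partial>Q)"
proof -
  have h_nonneg: "AE p in Q. 0 \<le> (case p of (\<omega>, t) \<Rightarrow> h \<omega> t)"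
    using order_trans[OF cost_rate_nonneg[OF I] le] by (intro AE_I2) (auto simp: space_pair_measure)
  have "optimal_cost c \<le> (\<integral>\<^sup>+p. ennreal (case p of (\<omega>, t) \<Rightarrow> h \<omega> t) \<partial>Q)"
    using optimal_cost_le[OF I] unfolding cost_eq[OF I]
    by (rule order_trans) (auto intro!: nn_integral_mono ennreal_leI le simp: space_pair_measure)
  also have "\<dots> = ennreal (\<integral>(\<omega>, t). h \<omega> t \<partial>Q)"
    by (rule nn_integral_eq_integral[OF h h_nonneg])
  finally show ?thesis
    using integral_nonneg_AE[OF h_nonneg] by (simp add: enn2real_leI)
qed

lemma
  assumes I: "I \<in> controls M F" and optimal: "optimal_cost c = cost c I"
  shows integrable_optimal_cost_rate: "integrable Q (\<lambda>(\<omega>, t). cost_rate c I \<omega> t)"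
    and v_eq_integral_cost_rate: "v c = (\<integral>(\<omega>, t). cost_rate c I \<omega> t \<partial>Q)"
proof -
  let ?r = "\<lambda>(\<omega>, t). cost_rate c I \<omega> t"
  have cost: "optimal_cost c = (\<integral>\<^sup>+p. ennreal (?r p) \<partial>Q)"
    by (simp add: optimal cost_eq[OF I] split_beta')
  have nonneg: "AE p in Q. 0 \<le> ?r p"
    using cost_rate_nonneg[OF I] by (intro AE_I2) (auto simp: space_pair_measure)
  show int: "integrable Q ?r"
    by (rule integrableI_nonneg[OF measurable_cost_rate[OF I] nonneg])
      (use optimal_cost_finite[of c] cost in simp)
  show "v c = (\<integral>p. ?r p \<partial>Q)"
    unfolding cost nn_integral_eq_integral[OF int nonneg]
    by (simp add: integral_nonneg_AE[OF nonneg])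
qed

subsection \<open>Convexity of the optimal cost\<close>

lemma controls_convex:
  assumes I: "I \<in> controls M F" and I': "I' \<in> controls M F" and u: "0 \<le> u" "u \<le> 1"
  shows "(\<lambda>t \<omega>. (1 - u) * I t \<omega> + u * I' t \<omega>) \<in> controls M F"
proof (rule controlsI)
  show "adapted F (\<lambda>t \<omega>. (1 - u) * I t \<omega> + u * I' t \<omega>)"
    unfolding adapted_def
  proof (intro allI impI)
    fix t :: real assume "0 \<le> t"
    then have [measurable]:
      "I t \<in> borel_measurable (F (ennreal t))" "I' t \<in> borel_measurable (F (ennreal t))"
      using controls_adapted[OF I] controls_adapted[OF I'] by (auto simp: adapted_def)
    show "(\<lambda>\<omega>. (1 - u) * I t \<omega> + u * I' t \<omega>) \<in> borel_measurable (F (ennreal t))" by measurable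
  qed
  show "cadlag_bv_path (\<lambda>t. (1 - u) * I t \<omega> + u * I' t \<omega>)" if "\<omega> \<in> space M" for \<omega>
    using u by (intro cadlag_bv_path_nonneg_combination control_path[OF _ that] I I') auto
qed

lemma cost_rate_convex:
  assumes I: "I \<in> controls M F" and I': "I' \<in> controls M F" and u: "0 \<le> u" "u \<le> 1"
    and \<omega>: "\<omega> \<in> space M" and t: "0 \<le> t"
  shows "cost_rate ((1 - u) * x + u * y) (\<lambda>t \<omega>. (1 - u) * I t \<omega> + u * I' t \<omega>) \<omega> t
    \<le> (1 - u) * cost_rate x I \<omega> t + u * cost_rate y I' \<omega> t"
proof -
  let ?K = "\<lambda>t \<omega>. (1 - u) * I t \<omega> + u * I' t \<omega>"
  have "(1 - u) *\<^sub>R (x + I t \<omega>) + u *\<^sub>R (y + I' t \<omega>) = (1 - u) * x + u * y + ?K t \<omega>"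
    by (simp add: algebra_simps)
  then have holding: "g ((1 - u) * x + u * y + ?K t \<omega>) (X t \<omega>) \<le>
      (1 - u) * g (x + I t \<omega>) (X t \<omega>) + u * g (y + I' t \<omega>) (X t \<omega>)"
    using convex_onD[OF g_convex[OF X_in[OF \<omega> t]] u, of "x + I t \<omega>" "y + I' t \<omega>"] by simp
  have "purchases ?K t \<omega> \<le> (1 - u) * purchases I t \<omega> + u * purchases I' t \<omega>"
    "sales ?K t \<omega> \<le> (1 - u) * sales I t \<omega> + u * sales I' t \<omega>"
    unfolding purchases_def sales_def using u
    by (auto intro!: pos_variation_nonneg_combination_le neg_variation_nonneg_combination_le
        control_path[OF _ \<omega>] I I' t)
  then have "qp * purchases ?K t \<omega> + qm * sales ?K t \<omega> \<le>
      qp * ((1 - u) * purchases I t \<omega> + u * purchases I' t \<omega>)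
      + qm * ((1 - u) * sales I t \<omega> + u * sales I' t \<omega>)"
    using qp_pos qm_pos by (intro add_mono mult_left_mono) auto
  from add_mono[OF holding mult_left_mono[OF this less_imp_le[OF \<rho>_pos]]]
  show ?thesis by (simp add: cost_rate_def algebra_simps)
qed

lemma cost_convex:
  assumes I: "I \<in> controls M F" and I': "I' \<in> controls M F" and u: "0 \<le> u" "u \<le> 1"
  shows "cost ((1 - u) * x + u * y) (\<lambda>t \<omega>. (1 - u) * I t \<omega> + u * I' t \<omega>)
    \<le> ennreal (1 - u) * cost x I + ennreal u * cost y I'"
proof -
  let ?K = "\<lambda>t \<omega>. (1 - u) * I t \<omega> + u * I' t \<omega>"
  note [measurable] = measurable_cost_rate[OF I] measurable_cost_rate[OF I']
  have "ennreal (cost_rate ((1 - u) * x + u * y) ?K \<omega> t) \<le>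
      ennreal (1 - u) * ennreal (cost_rate x I \<omega> t) + ennreal u * ennreal (cost_rate y I' \<omega> t)"
    if "\<omega> \<in> space M" "0 \<le> t" for \<omega> t
  proof -
    have "ennreal (cost_rate ((1 - u) * x + u * y) ?K \<omega> t) \<le>
        ennreal ((1 - u) * cost_rate x I \<omega> t + u * cost_rate y I' \<omega> t)"
      by (intro ennreal_leI cost_rate_convex[OF I I' u that])
    then show ?thesis
      using u cost_rate_nonneg[OF I that, of x] cost_rate_nonneg[OF I' that, of y]
      by (simp add: ennreal_mult ennreal_plus)
  qed
  then have "cost ((1 - u) * x + u * y) ?K \<le>
      (\<integral>\<^sup>+p. ennreal (1 - u) * ennreal (case p of (\<omega>, t) \<Rightarrow> cost_rate x I \<omega> t)
        + ennreal u * ennreal (case p of (\<omega>, t) \<Rightarrow> cost_rate y I' \<omega> t) \<partial>Q)"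
    unfolding cost_eq[OF controls_convex[OF I I' u]]
    by (intro nn_integral_mono) (auto simp: space_pair_measure)
  then show ?thesis
    by (simp add: cost_eq[OF I] cost_eq[OF I'] nn_integral_add nn_integral_cmult split_beta')
qed

lemma near_optimal_control:
  assumes "0 < \<epsilon>"
  obtains I where "I \<in> controls M F" "cost c I \<le> ennreal (v c + \<epsilon>)"
proof -
  have "ennreal (v c) < ennreal (v c + \<epsilon>)"
    using assms by (intro ennreal_lessI) (auto simp: add_nonneg_pos)
  then have "optimal_cost c < ennreal (v c + \<epsilon>)" unfolding ennreal_v .
  then show ?thesis using that unfolding optimal_cost_def INF_less_iff by (auto intro: less_imp_le)
qed

lemma convex_on_v: "convex_on UNIV v"
proof (rule convex_onI)
  fix u x y :: real assume u: "0 < u" "u < 1"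
  show "v ((1 - u) *\<^sub>R x + u *\<^sub>R y) \<le> (1 - u) * v x + u * v y"
  proof (rule field_le_epsilon)
    fix \<epsilon> :: real assume \<epsilon>: "0 < \<epsilon>"
    obtain I where I: "I \<in> controls M F" "cost x I \<le> ennreal (v x + \<epsilon>)"
      using near_optimal_control[OF \<epsilon>] .
    obtain I' where I': "I' \<in> controls M F" "cost y I' \<le> ennreal (v y + \<epsilon>)"
      using near_optimal_control[OF \<epsilon>] .
    have "optimal_cost ((1 - u) * x + u * y) \<le> ennreal (1 - u) * cost x I + ennreal u * cost y I'"
      using optimal_cost_le[OF controls_convex[OF I(1) I'(1)]] cost_convex[OF I(1) I'(1)] u
      by (meson less_imp_le order_trans)
    also have "\<dots> \<le> ennreal (1 - u) * ennreal (v x + \<epsilon>) + ennreal u * ennreal (v y + \<epsilon>)"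
      by (intro add_mono mult_left_mono I(2) I'(2)) auto
    also have "\<dots> = ennreal ((1 - u) * (v x + \<epsilon>) + u * (v y + \<epsilon>))"
      using u \<epsilon> by (simp add: ennreal_mult ennreal_plus)
    also have "(1 - u) * (v x + \<epsilon>) + u * (v y + \<epsilon>) = (1 - u) * v x + u * v y + \<epsilon>"
      by (simp add: algebra_simps)
    finally show "v ((1 - u) *\<^sub>R x + u *\<^sub>R y) \<le> (1 - u) * v x + u * v y + \<epsilon>"
      using u \<epsilon> by (simp add: enn2real_leI)
  qed
qed simp

subsection \<open>The payoff as an integral over time and chance\<close>

definition running_payoff :: "real \<Rightarrow> ('a \<Rightarrow> ennreal) \<Rightarrow> ('a \<Rightarrow> ennreal) \<Rightarrow> 'a \<Rightarrow> real \<Rightarrow> real" where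
  "running_payoff c \<sigma> \<tau> \<omega> t = (if ennreal t \<le> min (\<sigma> \<omega>) (\<tau> \<omega>) then gc c (X t \<omega>) else 0)"

definition payoff_rate :: "real \<Rightarrow> ('a \<Rightarrow> ennreal) \<Rightarrow> ('a \<Rightarrow> ennreal) \<Rightarrow> 'a \<Rightarrow> real \<Rightarrow> real" where
  "payoff_rate c \<sigma> \<tau> \<omega> t = running_payoff c \<sigma> \<tau> \<omega> t
     + \<rho> * (qm * stopped_first \<sigma> \<tau> \<omega> t - qp * stopped_first \<tau> \<sigma> \<omega> t)"

lemma measurable_stopping: "stopping_time F \<sigma> \<Longrightarrow> \<sigma> \<in> borel_measurable M"
  by (rule measurable_stopping_time[OF _ F_sub space_F])

lemma measurable_gc_X [measurable]: "(\<lambda>p. gc c (X (snd p) (fst p))) \<in> borel_measurable Q"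
  by (rule borel_measurable_continuous_on_X[OF gc_cont]) simp

lemma measurable_stopped_first:
  assumes [measurable]: "\<sigma> \<in> borel_measurable M" "\<tau> \<in> borel_measurable M"
  shows "(\<lambda>p. stopped_first \<sigma> \<tau> (fst p) (snd p)) \<in> borel_measurable Q"
  unfolding stopped_first_def by measurable

lemma integrable_stopped_first:
  assumes "\<sigma> \<in> borel_measurable M" "\<tau> \<in> borel_measurable M"
  shows "integrable Q (\<lambda>(\<omega>, t). stopped_first \<sigma> \<tau> \<omega> t)"
  using measurable_stopped_first[OF assms]
  by (intro Q.integrable_const_bound[where B=1]) (auto simp: stopped_first_def split_beta')

lemma integrable_running_payoff:
  assumes [measurable]: "\<sigma> \<in> borel_measurable M" "\<tau> \<in> borel_measurable M"
  shows "integrable Q (\<lambda>(\<omega>, t). running_payoff c \<sigma> \<tau> \<omega> t)"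
proof (rule Bochner_Integration.integrable_bound[OF gc_integrable[of c]])
  show "(\<lambda>(\<omega>, t). running_payoff c \<sigma> \<tau> \<omega> t) \<in> borel_measurable Q"
    unfolding running_payoff_def split_beta' by measurable
qed (auto simp: running_payoff_def)

lemma integrable_payoff_rate:
  assumes "\<sigma> \<in> borel_measurable M" "\<tau> \<in> borel_measurable M"
  shows "integrable Q (\<lambda>(\<omega>, t). payoff_rate c \<sigma> \<tau> \<omega> t)"
  using integrable_running_payoff[OF assms] integrable_stopped_first[OF assms]
    integrable_stopped_first[OF assms(2,1)]
  by (simp add: payoff_rate_def split_beta')

lemma integral_stopped_first:
  "(LINT t|disc_lborel \<rho>. stopped_first \<sigma> \<tau> \<omega> t) = (if \<sigma> \<omega> < \<tau> \<omega> then discount \<rho> (\<sigma> \<omega>) / \<rho> else 0)"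
  using integral_disc_lborel_stop[OF \<rho>_pos, of "\<sigma> \<omega>" 1] by (simp add: stopped_first_def)

lemma integral_running_payoff:
  assumes \<omega>: "\<omega> \<in> space M" and "\<sigma> \<in> borel_measurable M" "\<tau> \<in> borel_measurable M"
  shows "(LINT t|disc_lborel \<rho>. running_payoff c \<sigma> \<tau> \<omega> t) =
    (LINT t:{t. 0 \<le> t \<and> ennreal t \<le> min (\<sigma> \<omega>) (\<tau> \<omega>)}|lborel. exp (- \<rho> * t) * gc c (X t \<omega>))"
proof -
  have "(\<lambda>t. running_payoff c \<sigma> \<tau> \<omega> t) \<in> borel_measurable (disc_lborel \<rho>)"
    using borel_measurable_integrable[OF integrable_running_payoff[OF assms(2,3)]] \<omega>
    by (auto dest: measurable_Pair2)
  from integral_disc_lborel[OF this] show ?thesis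
    by (auto simp: set_lebesgue_integral_def running_payoff_def indicator_def
        intro!: Bochner_Integration.integral_cong)
qed

lemma payoff_eq:
  assumes \<sigma>: "stopping_time F \<sigma>" and \<tau>: "stopping_time F \<tau>"
  shows "payoff c \<sigma> \<tau> = (\<integral>(\<omega>, t). payoff_rate c \<sigma> \<tau> \<omega> t \<partial>Q)"
proof -
  note measurable = measurable_stopping[OF \<sigma>] measurable_stopping[OF \<tau>]
  let ?R = "\<lambda>\<omega> t. running_payoff c \<sigma> \<tau> \<omega> t"
  let ?S = "\<lambda>\<omega> t. stopped_first \<sigma> \<tau> \<omega> t" and ?T = "\<lambda>\<omega> t. stopped_first \<tau> \<sigma> \<omega> t"
  note integrable = integrable_running_payoff[OF measurable, of c]
    integrable_stopped_first[OF measurable] integrable_stopped_first[OF measurable(2,1)]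
  note integrable_slice = integrable[THEN MxL.integrable_fst', simplified]
  note integral_slice = integrable[THEN MxL.integral_fst', simplified]
  have "payoff c \<sigma> \<tau> = (LINT \<omega>|M. (LINT t|disc_lborel \<rho>. ?R \<omega> t)
      + \<rho> * (qm * (LINT t|disc_lborel \<rho>. ?S \<omega> t) - qp * (LINT t|disc_lborel \<rho>. ?T \<omega> t)))"
    unfolding dynkin_payoff_def using \<rho>_pos
    by (intro Bochner_Integration.integral_cong)
      (simp_all add: integral_running_payoff[OF _ measurable] integral_stopped_first field_simps)
  also have "\<dots> = (\<integral>(\<omega>, t). ?R \<omega> t \<partial>Q) + \<rho> * (qm * (\<integral>(\<omega>, t). ?S \<omega> t \<partial>Q) - qp * (\<integral>(\<omega>, t). ?T \<omega> t \<partial>Q))"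
    using integrable_slice integral_slice by simp
  also have "\<dots> = (\<integral>(\<omega>, t). payoff_rate c \<sigma> \<tau> \<omega> t \<partial>Q)"
    using integrable by (simp add: payoff_rate_def split_beta')
  finally show ?thesis .
qed

lemma AE_neq_stopping_time:
  assumes [measurable]: "\<sigma> \<in> borel_measurable M"
  shows "AE (\<omega>, t) in Q. ennreal t \<noteq> \<sigma> \<omega>"
proof -
  have "AE p in Q. ennreal (snd p) \<noteq> \<sigma> (fst p)"
  proof (rule MxL.AE_pair_measure)
    show "{p \<in> space Q. ennreal (snd p) \<noteq> \<sigma> (fst p)} \<in> sets Q" by measurable
    show "AE \<omega> in M. AE t in disc_lborel \<rho>. ennreal (snd (\<omega>, t)) \<noteq> \<sigma> (fst (\<omega>, t))"
    proof (rule AE_I2)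
      fix \<omega>
      have "AE t in disc_lborel \<rho>. 0 \<le> t" by (rule AE_I2) simp
      with AE_disc_lborel_neq[of "enn2real (\<sigma> \<omega>)" \<rho>]
      show "AE t in disc_lborel \<rho>. ennreal (snd (\<omega>, t)) \<noteq> \<sigma> (fst (\<omega>, t))"
      proof eventually_elim
        case (elim t)
        then have "enn2real (ennreal t) \<noteq> enn2real (\<sigma> \<omega>)" by simp
        then show ?case by auto
      qed
    qed
  qed
  then show ?thesis by (simp add: split_beta')
qed

end

subsection \<open>Perturbation of an optimal control\<close>

text \<open>The absorbed and the sold part of the excess \<open>\<epsilon>\<close> are counted as fractions of \<open>\<epsilon>\<close>.\<close>

definition absorbed :: "(real \<Rightarrow> 'a \<Rightarrow> real) \<Rightarrow> ('a \<Rightarrow> ennreal) \<Rightarrow> real \<Rightarrow> 'a \<Rightarrow> real \<Rightarrow> real" where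
  "absorbed I \<sigma> \<epsilon> \<omega> t = (if \<sigma> \<omega> < purchase_time I \<omega> then 0 else min 1 (purchases I t \<omega> / \<epsilon>))"

abbreviation sold :: "(real \<Rightarrow> 'a \<Rightarrow> real) \<Rightarrow> ('a \<Rightarrow> ennreal) \<Rightarrow> 'a \<Rightarrow> real \<Rightarrow> real" where
  "sold I \<sigma> \<equiv> stopped_first \<sigma> (purchase_time I)"

definition perturbed :: "(real \<Rightarrow> 'a \<Rightarrow> real) \<Rightarrow> ('a \<Rightarrow> ennreal) \<Rightarrow> real \<Rightarrow> real \<Rightarrow> 'a \<Rightarrow> real" where
  "perturbed I \<sigma> \<epsilon> t \<omega> = I t \<omega> - \<epsilon> * (absorbed I \<sigma> \<epsilon> \<omega> t + sold I \<sigma> \<omega> t)"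

context control_problem
begin

lemma purchases_before_purchase_time:
  assumes "I \<in> controls M F" "\<omega> \<in> space M" "0 \<le> t" "ennreal t < purchase_time I \<omega>"
  shows "purchases I t \<omega> = 0"
  using first_positive_time_le[OF assms(3), of "\<lambda>t. purchases I t \<omega>"] assms(4)
    purchases_nonneg[OF assms(1-3)]
  by (force simp: purchase_time_altdef[symmetric])

lemma purchases_after_purchase_time:
  assumes "I \<in> controls M F" "\<omega> \<in> space M" "purchase_time I \<omega> < ennreal t"
  shows "0 < purchases I t \<omega>"
proof -
  obtain s where "0 \<le> s" "ennreal s < ennreal t" "0 < purchases I s \<omega>"
    using assms(3) by (auto simp: purchase_time_altdef first_positive_time_less_iff)
  then show ?thesis
    using increasing_path_mono[OF increasing_purchases[OF assms(1,2)], of s t]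
    by (simp add: ennreal_less_iff)
qed

lemma absorbed_nonneg:
  "I \<in> controls M F \<Longrightarrow> \<omega> \<in> space M \<Longrightarrow> 0 \<le> t \<Longrightarrow> 0 < \<epsilon> \<Longrightarrow> 0 \<le> absorbed I \<sigma> \<epsilon> \<omega> t"
  by (simp add: absorbed_def purchases_nonneg)

lemma absorbed_plus_sold_le_1: "absorbed I \<sigma> \<epsilon> \<omega> t + sold I \<sigma> \<omega> t \<le> 1"
  by (simp add: absorbed_def stopped_first_def)

lemma excess_remaining_imp_purchases_absorbed:
  assumes I: "I \<in> controls M F" and \<omega>: "\<omega> \<in> space M" and t: "0 \<le> t" and \<epsilon>: "0 < \<epsilon>"
    and remaining: "absorbed I \<sigma> \<epsilon> \<omega> t + sold I \<sigma> \<omega> t \<noteq> 1"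
  shows "purchases I t \<omega> = \<epsilon> * absorbed I \<sigma> \<epsilon> \<omega> t"
proof (cases "\<sigma> \<omega> < purchase_time I \<omega>")
  case True
  then have "ennreal t < \<sigma> \<omega>"
    using remaining by (auto simp: absorbed_def stopped_first_def split: if_splits)
  then have "purchases I t \<omega> = 0"
    using True by (intro purchases_before_purchase_time[OF I \<omega> t]) simp
  then show ?thesis using True by (simp add: absorbed_def)
next
  case False
  then show ?thesis using remaining \<epsilon> by (auto simp: absorbed_def stopped_first_def min_def)
qed

lemma
  assumes I: "I \<in> controls M F" and \<omega>: "\<omega> \<in> space M" and \<epsilon>: "0 < \<epsilon>"
  shows cadlag_bv_path_perturbed: "cadlag_bv_path (\<lambda>t. perturbed I \<sigma> \<epsilon> t \<omega>)"
    and purchases_perturbed_le: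
      "0 \<le> t \<Longrightarrow> purchases (perturbed I \<sigma> \<epsilon>) t \<omega> \<le> purchases I t \<omega> - \<epsilon> * absorbed I \<sigma> \<epsilon> \<omega> t"
    and sales_perturbed_le:
      "0 \<le> t \<Longrightarrow> sales (perturbed I \<sigma> \<epsilon>) t \<omega> \<le> sales I t \<omega> + \<epsilon> * sold I \<sigma> \<omega> t"
proof -
  have "(\<lambda>t. purchases I t \<omega> - \<epsilon> * absorbed I \<sigma> \<epsilon> \<omega> t) =
      (if \<sigma> \<omega> < purchase_time I \<omega> then (\<lambda>t. purchases I t \<omega>)
       else (\<lambda>t. purchases I t \<omega> - min \<epsilon> (purchases I t \<omega>)))"
    using \<epsilon> by (auto simp: fun_eq_iff absorbed_def min_def field_simps)
  then have pos: "increasing_path (\<lambda>t. purchases I t \<omega> - \<epsilon> * absorbed I \<sigma> \<epsilon> \<omega> t)"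
    using increasing_purchases[OF I \<omega>] increasing_path_excess[OF increasing_purchases[OF I \<omega>], of \<epsilon>]
    by simp
  have "increasing_path (\<lambda>t. sold I \<sigma> \<omega> t)"
    unfolding stopped_first_def
    using increasing_path_step increasing_path_zero by (cases "\<sigma> \<omega> < purchase_time I \<omega>") simp_all
  then have neg: "increasing_path (\<lambda>t. sales I t \<omega> + \<epsilon> * sold I \<sigma> \<omega> t)"
    using \<epsilon> by (intro increasing_path_add increasing_path_cmult increasing_sales[OF I \<omega>]) auto
  have difference: "perturbed I \<sigma> \<epsilon> t \<omega> =
      (purchases I t \<omega> - \<epsilon> * absorbed I \<sigma> \<epsilon> \<omega> t) - (sales I t \<omega> + \<epsilon> * sold I \<sigma> \<omega> t)"
    if "0 \<le> t" for t
    by (simp add: perturbed_def control_decomposition[OF I \<omega> that] algebra_simps)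
  show "cadlag_bv_path (\<lambda>t. perturbed I \<sigma> \<epsilon> t \<omega>)"
    by (rule cadlag_bv_path_difference[OF pos neg difference])
  show "0 \<le> t \<Longrightarrow> purchases (perturbed I \<sigma> \<epsilon>) t \<omega> \<le> purchases I t \<omega> - \<epsilon> * absorbed I \<sigma> \<epsilon> \<omega> t"
    using pos_variation_difference_le[OF pos neg difference]
    by (simp add: purchases_def[of "perturbed I \<sigma> \<epsilon>"])
  show "0 \<le> t \<Longrightarrow> sales (perturbed I \<sigma> \<epsilon>) t \<omega> \<le> sales I t \<omega> + \<epsilon> * sold I \<sigma> \<omega> t"
    using neg_variation_difference_le[OF pos neg difference]
    by (simp add: sales_def[of "perturbed I \<sigma> \<epsilon>"])
qed

lemma perturbed_in_controls:
  assumes I: "I \<in> controls M F" and \<sigma>: "stopping_time F \<sigma>" and \<epsilon>: "0 < \<epsilon>"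
  shows "perturbed I \<sigma> \<epsilon> \<in> controls M F"
proof (rule controlsI)
  show "adapted F (perturbed I \<sigma> \<epsilon>)"
    unfolding adapted_def
  proof (intro allI impI)
    fix t :: real assume t: "0 \<le> t"
    note [measurable] = controls_adapted[OF I, unfolded adapted_def, rule_format, OF t]
      purchases_adapted[OF I, unfolded adapted_def, rule_format, OF t]
    have "{\<omega>\<in>space (pre_sigma \<sigma>). \<sigma> \<omega> < purchase_time I \<omega>} \<in> sets (pre_sigma \<sigma>)"
      using stopping_time_less[OF \<sigma> stopping_time_purchase_time[OF I]] by (simp add: pred_def)
    from sets_pre_sigmaD[OF \<sigma> this, of "ennreal t"]
    have [measurable]:
      "Measurable.pred (F (ennreal t)) (\<lambda>\<omega>. \<sigma> \<omega> < purchase_time I \<omega> \<and> \<sigma> \<omega> \<le> ennreal t)"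
      by (simp add: pred_def space_pre_sigma space_F conj_assoc)
    have "perturbed I \<sigma> \<epsilon> t \<omega> = I t \<omega> -
        (if \<sigma> \<omega> < purchase_time I \<omega> \<and> \<sigma> \<omega> \<le> ennreal t then \<epsilon> else min \<epsilon> (purchases I t \<omega>))"
      if \<omega>: "\<omega> \<in> space M" for \<omega>
    proof (cases "\<sigma> \<omega> < purchase_time I \<omega> \<and> ennreal t < \<sigma> \<omega>")
      case True
      then have "purchases I t \<omega> = 0" by (intro purchases_before_purchase_time[OF I \<omega> t]) auto
      then show ?thesis using True \<epsilon> by (auto simp: perturbed_def absorbed_def stopped_first_def)
    next
      case False
      then show ?thesis
        using \<epsilon> by (auto simp: perturbed_def absorbed_def stopped_first_def min_def field_simps)
    qed
    moreover have "(\<lambda>\<omega>. I t \<omega> -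
        (if \<sigma> \<omega> < purchase_time I \<omega> \<and> \<sigma> \<omega> \<le> ennreal t then \<epsilon> else min \<epsilon> (purchases I t \<omega>)))
        \<in> borel_measurable (F (ennreal t))" by measurable
    ultimately show "perturbed I \<sigma> \<epsilon> t \<in> borel_measurable (F (ennreal t))"
      by (subst measurable_cong) (auto simp: space_F)
  qed
qed (rule cadlag_bv_path_perturbed[OF I _ \<epsilon>])

definition slope ::
  "real \<Rightarrow> (real \<Rightarrow> 'a \<Rightarrow> real) \<Rightarrow> ('a \<Rightarrow> ennreal) \<Rightarrow> real \<Rightarrow> 'a \<Rightarrow> real \<Rightarrow> real" where
  "slope c I \<sigma> \<epsilon> \<omega> t =
     (1 - absorbed I \<sigma> \<epsilon> \<omega> t - sold I \<sigma> \<omega> t) * gc (c + \<epsilon>) (X t \<omega>)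
     + \<rho> * (qm * sold I \<sigma> \<omega> t - qp * absorbed I \<sigma> \<epsilon> \<omega> t)"

lemma holding_cost_perturbed_le:
  assumes I: "I \<in> controls M F" and \<omega>: "\<omega> \<in> space M" and t: "0 \<le> t" and \<epsilon>: "0 < \<epsilon>"
  shows "g (c + \<epsilon> + perturbed I \<sigma> \<epsilon> t \<omega>) (X t \<omega>) \<le> g (c + I t \<omega>) (X t \<omega>)
    + \<epsilon> * (1 - absorbed I \<sigma> \<epsilon> \<omega> t - sold I \<sigma> \<omega> t) * gc (c + \<epsilon>) (X t \<omega>)"
proof -
  define r where "r = \<epsilon> * (1 - absorbed I \<sigma> \<epsilon> \<omega> t - sold I \<sigma> \<omega> t)"
  have level: "c + \<epsilon> + perturbed I \<sigma> \<epsilon> t \<omega> = c + I t \<omega> + r"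
    by (simp add: r_def perturbed_def algebra_simps)
  have x: "X t \<omega> \<in> U" by (rule X_in[OF \<omega> t])
  have "g (c + I t \<omega> + r) (X t \<omega>) - g (c + I t \<omega>) (X t \<omega>) \<le> r * gc (c + I t \<omega> + r) (X t \<omega>)"
    using tangent_le[OF x, of "c + I t \<omega> + r" "c + I t \<omega>"] by (simp add: algebra_simps)
  also have "\<dots> \<le> r * gc (c + \<epsilon>) (X t \<omega>)"
  proof (cases "r = 0")
    case False
    then have "purchases I t \<omega> = \<epsilon> * absorbed I \<sigma> \<epsilon> \<omega> t"
      by (intro excess_remaining_imp_purchases_absorbed[OF I \<omega> t \<epsilon>]) (auto simp: r_def)
    then have "I t \<omega> + r = \<epsilon> - sales I t \<omega> - \<epsilon> * sold I \<sigma> \<omega> t"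
      by (simp add: r_def control_decomposition[OF I \<omega> t] algebra_simps)
    then have "c + I t \<omega> + r \<le> c + \<epsilon>"
      using sales_nonneg[OF I \<omega> t] mult_nonneg_nonneg[OF less_imp_le[OF \<epsilon>] stopped_first_nonneg]
      by (smt (verit))
    moreover have "0 \<le> r"
      using \<epsilon> absorbed_plus_sold_le_1[of I \<sigma> \<epsilon> \<omega> t] by (simp add: r_def)
    ultimately show ?thesis by (intro mult_left_mono gc_mono[OF x])
  qed simp
  finally show ?thesis by (simp add: level r_def)
qed

lemma cost_rate_perturbed_le:
  assumes I: "I \<in> controls M F" and \<omega>: "\<omega> \<in> space M" and t: "0 \<le> t" and \<epsilon>: "0 < \<epsilon>"
  shows "cost_rate (c + \<epsilon>) (perturbed I \<sigma> \<epsilon>) \<omega> t \<le> cost_rate c I \<omega> t + \<epsilon> * slope c I \<sigma> \<epsilon> \<omega> t"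
proof -
  have "qp * purchases (perturbed I \<sigma> \<epsilon>) t \<omega> + qm * sales (perturbed I \<sigma> \<epsilon>) t \<omega> \<le>
      qp * (purchases I t \<omega> - \<epsilon> * absorbed I \<sigma> \<epsilon> \<omega> t) + qm * (sales I t \<omega> + \<epsilon> * sold I \<sigma> \<omega> t)"
    using qp_pos qm_pos
    by (intro add_mono mult_left_mono purchases_perturbed_le[OF I \<omega> \<epsilon> t]
        sales_perturbed_le[OF I \<omega> \<epsilon> t]) auto
  from mult_left_mono[OF this less_imp_le[OF \<rho>_pos]]
  have "\<rho> * (qp * purchases (perturbed I \<sigma> \<epsilon>) t \<omega> + qm * sales (perturbed I \<sigma> \<epsilon>) t \<omega>) \<le>
      \<rho> * (qp * (purchases I t \<omega> - \<epsilon> * absorbed I \<sigma> \<epsilon> \<omega> t)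
        + qm * (sales I t \<omega> + \<epsilon> * sold I \<sigma> \<omega> t))" .
  from add_mono[OF holding_cost_perturbed_le[OF I \<omega> t \<epsilon>, of c \<sigma>] this]
  show ?thesis unfolding cost_rate_def slope_def by (simp only: algebra_simps)
qed

subsection \<open>The limit of the slopes\<close>

definition absorbed_limit :: "(real \<Rightarrow> 'a \<Rightarrow> real) \<Rightarrow> ('a \<Rightarrow> ennreal) \<Rightarrow> 'a \<Rightarrow> real \<Rightarrow> real" where
  "absorbed_limit I \<sigma> \<omega> t =
     (if purchase_time I \<omega> \<le> \<sigma> \<omega> \<and> purchase_time I \<omega> \<le> ennreal t then 1 else 0)"

definition slope_limit :: "real \<Rightarrow> (real \<Rightarrow> 'a \<Rightarrow> real) \<Rightarrow> ('a \<Rightarrow> ennreal) \<Rightarrow> 'a \<Rightarrow> real \<Rightarrow> real" where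
  "slope_limit c I \<sigma> \<omega> t =
     (1 - absorbed_limit I \<sigma> \<omega> t - sold I \<sigma> \<omega> t) * gc c (X t \<omega>)
     + \<rho> * (qm * sold I \<sigma> \<omega> t - qp * absorbed_limit I \<sigma> \<omega> t)"

lemma absorbed_tendsto:
  assumes I: "I \<in> controls M F" and \<omega>: "\<omega> \<in> space M" and t: "0 \<le> t"
    and "ennreal t \<noteq> purchase_time I \<omega>"
  shows "((\<lambda>\<epsilon>. absorbed I \<sigma> \<epsilon> \<omega> t) \<longlongrightarrow> absorbed_limit I \<sigma> \<omega> t) (at_right 0)"
proof (cases "ennreal t < purchase_time I \<omega>")
  case True
  then have "absorbed I \<sigma> \<epsilon> \<omega> t = absorbed_limit I \<sigma> \<omega> t" for \<epsilon>
    using purchases_before_purchase_time[OF I \<omega> t True]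
    by (auto simp: absorbed_def absorbed_limit_def)
  then show ?thesis by simp
next
  case False
  then have after: "purchase_time I \<omega> < ennreal t" using assms(4) by simp
  have "\<forall>\<^sub>F \<epsilon> :: real in at_right 0. \<epsilon> < purchases I t \<omega>"
    by (rule order_tendstoD(2)[OF tendsto_ident_at purchases_after_purchase_time[OF I \<omega> after]])
  with eventually_at_right_less[of "0 :: real"]
  have "\<forall>\<^sub>F \<epsilon> in at_right 0. absorbed I \<sigma> \<epsilon> \<omega> t = absorbed_limit I \<sigma> \<omega> t"
    by eventually_elim (use after in \<open>auto simp: absorbed_def absorbed_limit_def not_less\<close>)
  then show ?thesis by (rule tendsto_eventually)
qed

lemma gc_tendsto:
  assumes "d \<in> U"
  shows "((\<lambda>\<epsilon>. gc (c + \<epsilon>) d) \<longlongrightarrow> gc c d) (at_right 0)"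
proof -
  have "continuous_on UNIV (\<lambda>\<epsilon>. case (c + \<epsilon>, d) of (c, d) \<Rightarrow> gc c d)"
    by (rule continuous_on_compose2[OF gc_cont]) (use assms in \<open>auto intro!: continuous_intros\<close>)
  then have "isCont (\<lambda>\<epsilon>. gc (c + \<epsilon>) d) 0" by (simp add: continuous_on_eq_continuous_at)
  from tendsto_mono[OF at_le this[unfolded isCont_def]] show ?thesis by simp
qed

lemma slope_tendsto:
  assumes "I \<in> controls M F" "\<omega> \<in> space M" "0 \<le> t" "ennreal t \<noteq> purchase_time I \<omega>"
  shows "((\<lambda>\<epsilon>. slope c I \<sigma> \<epsilon> \<omega> t) \<longlongrightarrow> slope_limit c I \<sigma> \<omega> t) (at_right 0)"
  unfolding slope_def slope_limit_def
  by (intro tendsto_intros absorbed_tendsto gc_tendsto X_in assms)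

lemma slope_limit_le_payoff_rate:
  assumes "ennreal t \<noteq> \<sigma> \<omega>" "ennreal t \<noteq> purchase_time I \<omega>"
  shows "slope_limit c I \<sigma> \<omega> t \<le> payoff_rate c \<sigma> (purchase_time I) \<omega> t"
proof -
  note rates = slope_limit_def payoff_rate_def running_payoff_def absorbed_limit_def
    stopped_first_def
  consider (running) "ennreal t < \<sigma> \<omega>" "ennreal t < purchase_time I \<omega>"
    | (sold) "\<sigma> \<omega> < purchase_time I \<omega>" "\<sigma> \<omega> < ennreal t"
    | (absorbed) "purchase_time I \<omega> \<le> \<sigma> \<omega>" "purchase_time I \<omega> < ennreal t"
    using assms by (metis leI le_less_trans less_le_trans order_le_less)
  then show ?thesis
  proof cases
    case running
    then have "\<not> \<sigma> \<omega> \<le> ennreal t" "\<not> purchase_time I \<omega> \<le> ennreal t" by auto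
    then show ?thesis using running by (simp add: rates less_imp_le)
  next
    case sold
    then have "\<not> purchase_time I \<omega> \<le> \<sigma> \<omega>" "\<not> purchase_time I \<omega> < \<sigma> \<omega>" "\<not> ennreal t \<le> \<sigma> \<omega>"
      by auto
    then show ?thesis using sold by (simp add: rates less_imp_le)
  next
    case absorbed
    then show ?thesis using \<rho>_pos qp_pos by (auto simp: rates leD)
  qed
qed

definition slope_bound :: "real \<Rightarrow> 'a \<Rightarrow> real \<Rightarrow> real" where
  "slope_bound c \<omega> t = \<bar>gc c (X t \<omega>)\<bar> + \<bar>gc (c + 1) (X t \<omega>)\<bar> + \<rho> * (qm + qp)"

lemma integrable_slope_bound: "integrable Q (\<lambda>(\<omega>, t). slope_bound c \<omega> t)"
  using integrable_abs[OF gc_integrable[of c]] integrable_abs[OF gc_integrable[of "c + 1"]]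
  by (simp add: slope_bound_def split_beta')

lemma abs_slope_combination_le:
  assumes "\<omega> \<in> space M" "0 \<le> t" and \<epsilon>: "0 \<le> \<epsilon>" "\<epsilon> \<le> 1" and ab: "0 \<le> a" "0 \<le> b" "a + b \<le> 1"
  shows "\<bar>(1 - a - b) * gc (c + \<epsilon>) (X t \<omega>) + \<rho> * (qm * b - qp * a)\<bar> \<le> slope_bound c \<omega> t"
proof -
  have "gc c (X t \<omega>) \<le> gc (c + \<epsilon>) (X t \<omega>)" "gc (c + \<epsilon>) (X t \<omega>) \<le> gc (c + 1) (X t \<omega>)"
    using \<epsilon> by (auto intro!: gc_mono X_in assms)
  then have "\<bar>gc (c + \<epsilon>) (X t \<omega>)\<bar> \<le> \<bar>gc c (X t \<omega>)\<bar> + \<bar>gc (c + 1) (X t \<omega>)\<bar>" by linarith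
  moreover have "\<bar>(1 - a - b) * gc (c + \<epsilon>) (X t \<omega>)\<bar> \<le> 1 * \<bar>gc (c + \<epsilon>) (X t \<omega>)\<bar>"
    unfolding abs_mult using ab by (intro mult_right_mono) auto
  moreover have "0 \<le> qm * b" "qm * b \<le> qm" "0 \<le> qp * a" "qp * a \<le> qp"
    using ab qp_pos qm_pos by (auto intro: mult_left_le)
  then have "\<bar>qm * b - qp * a\<bar> \<le> qm + qp" using qp_pos qm_pos by linarith
  then have "\<bar>\<rho> * (qm * b - qp * a)\<bar> \<le> \<rho> * (qm + qp)"
    using \<rho>_pos by (simp add: abs_mult)
  ultimately show ?thesis unfolding slope_bound_def by linarith
qed

lemma abs_slope_le:
  assumes "I \<in> controls M F" "\<omega> \<in> space M" "0 \<le> t" "0 < \<epsilon>" "\<epsilon> \<le> 1"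
  shows "\<bar>slope c I \<sigma> \<epsilon> \<omega> t\<bar> \<le> slope_bound c \<omega> t"
  unfolding slope_def
  by (intro abs_slope_combination_le absorbed_nonneg stopped_first_nonneg absorbed_plus_sold_le_1
      assms less_imp_le[OF assms(4)])

lemma abs_slope_limit_le:
  assumes "\<omega> \<in> space M" "0 \<le> t"
  shows "\<bar>slope_limit c I \<sigma> \<omega> t\<bar> \<le> slope_bound c \<omega> t"
  using abs_slope_combination_le[OF assms, of 0 "absorbed_limit I \<sigma> \<omega> t" "sold I \<sigma> \<omega> t" c]
  by (auto simp: slope_limit_def absorbed_limit_def stopped_first_def)

lemma
  assumes I: "I \<in> controls M F" and \<sigma>: "stopping_time F \<sigma>"
  shows measurable_slope: "(\<lambda>(\<omega>, t). slope c I \<sigma> \<epsilon> \<omega> t) \<in> borel_measurable Q"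
    and measurable_slope_limit: "(\<lambda>(\<omega>, t). slope_limit c I \<sigma> \<omega> t) \<in> borel_measurable Q"
proof -
  note [measurable] = measurable_stopping[OF \<sigma>]
    measurable_stopping[OF stopping_time_purchase_time[OF I]]
    measurable_purchases[OF I] measurable_stopped_first
  show "(\<lambda>(\<omega>, t). slope c I \<sigma> \<epsilon> \<omega> t) \<in> borel_measurable Q"
    unfolding slope_def absorbed_def split_beta' by measurable
  show "(\<lambda>(\<omega>, t). slope_limit c I \<sigma> \<omega> t) \<in> borel_measurable Q"
    unfolding slope_limit_def absorbed_limit_def split_beta' by measurable
qed

lemma integrable_slope:
  assumes I: "I \<in> controls M F" and \<sigma>: "stopping_time F \<sigma>" and \<epsilon>: "0 < \<epsilon>" "\<epsilon> \<le> 1"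
  shows "integrable Q (\<lambda>(\<omega>, t). slope c I \<sigma> \<epsilon> \<omega> t)"
  using abs_slope_le[OF I _ _ \<epsilon>]
  by (intro Bochner_Integration.integrable_bound[OF integrable_slope_bound[of c]]
      measurable_slope[OF I \<sigma>])
    (auto intro!: AE_I2 intro: order_trans[OF _ abs_ge_self] simp: space_pair_measure)

lemma integrable_slope_limit:
  assumes I: "I \<in> controls M F" and \<sigma>: "stopping_time F \<sigma>"
  shows "integrable Q (\<lambda>(\<omega>, t). slope_limit c I \<sigma> \<omega> t)"
  using abs_slope_limit_le
  by (intro Bochner_Integration.integrable_bound[OF integrable_slope_bound[of c]]
      measurable_slope_limit[OF I \<sigma>])
    (auto intro!: AE_I2 intro: order_trans[OF _ abs_ge_self] simp: space_pair_measure)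

lemma integral_slope_tendsto:
  assumes I: "I \<in> controls M F" and \<sigma>: "stopping_time F \<sigma>"
  shows "((\<lambda>\<epsilon>. \<integral>(\<omega>, t). slope c I \<sigma> \<epsilon> \<omega> t \<partial>Q) \<longlongrightarrow> (\<integral>(\<omega>, t). slope_limit c I \<sigma> \<omega> t \<partial>Q)) (at_right 0)"
proof (rule tendsto_at_right_sequentially[of 0 1])
  fix S :: "nat \<Rightarrow> real" assume S: "\<And>n. 0 < S n" "\<And>n. S n < 1" "S \<longlonglongrightarrow> 0"
  then have S_at_right: "filterlim S (at_right 0) sequentially"
    by (simp add: filterlim_at less_imp_neq[THEN not_sym])
  have "AE p in Q. p \<in> space Q" by (rule AE_I2)
  with AE_neq_stopping_time[OF measurable_stopping[OF stopping_time_purchase_time[OF I]]]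
  have limit: "AE p in Q. (\<lambda>n. case p of (\<omega>, t) \<Rightarrow> slope c I \<sigma> (S n) \<omega> t)
      \<longlonglongrightarrow> (case p of (\<omega>, t) \<Rightarrow> slope_limit c I \<sigma> \<omega> t)"
  proof eventually_elim
    case (elim p)
    then show ?case
      using filterlim_compose[OF slope_tendsto[OF I] S_at_right]
      by (auto simp: space_pair_measure)
  qed
  have bound: "AE p in Q. norm (case p of (\<omega>, t) \<Rightarrow> slope c I \<sigma> (S n) \<omega> t)
      \<le> (case p of (\<omega>, t) \<Rightarrow> slope_bound c \<omega> t)" for n
    using abs_slope_le[OF I _ _ S(1) less_imp_le[OF S(2)]]
    by (intro AE_I2) (auto simp: space_pair_measure)
  show "(\<lambda>n. \<integral>(\<omega>, t). slope c I \<sigma> (S n) \<omega> t \<partial>Q) \<longlonglongrightarrow> (\<integral>(\<omega>, t). slope_limit c I \<sigma> \<omega> t \<partial>Q)"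
    by (rule integral_dominated_convergence[OF measurable_slope_limit[OF I \<sigma>]
          measurable_slope[OF I \<sigma>] integrable_slope_bound limit bound])
qed simp

lemma integral_slope_limit_le_payoff:
  assumes I: "I \<in> controls M F" and \<sigma>: "stopping_time F \<sigma>"
  shows "(\<integral>(\<omega>, t). slope_limit c I \<sigma> \<omega> t \<partial>Q) \<le> payoff c \<sigma> (purchase_time I)"
proof -
  note measurable = measurable_stopping[OF \<sigma>]
    measurable_stopping[OF stopping_time_purchase_time[OF I]]
  have "AE p in Q. (case p of (\<omega>, t) \<Rightarrow> slope_limit c I \<sigma> \<omega> t)
      \<le> (case p of (\<omega>, t) \<Rightarrow> payoff_rate c \<sigma> (purchase_time I) \<omega> t)"
    using AE_neq_stopping_time[OF measurable(1)] AE_neq_stopping_time[OF measurable(2)]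
    by eventually_elim (auto intro: slope_limit_le_payoff_rate)
  then show ?thesis
    unfolding payoff_eq[OF \<sigma> stopping_time_purchase_time[OF I]]
    by (rule integral_mono_AE[OF integrable_slope_limit[OF I \<sigma>] integrable_payoff_rate[OF measurable]])
qed

lemma v_perturbed_le:
  assumes I: "I \<in> controls M F" and optimal: "optimal_cost c = cost c I" and \<sigma>: "stopping_time F \<sigma>"
    and \<epsilon>: "0 < \<epsilon>" "\<epsilon> \<le> 1"
  shows "v (c + \<epsilon>) \<le> v c + \<epsilon> * (\<integral>(\<omega>, t). slope c I \<sigma> \<epsilon> \<omega> t \<partial>Q)"
proof -
  note integrable = integrable_optimal_cost_rate[OF I optimal] integrable_slope[OF I \<sigma> \<epsilon>, of c]
  have "v (c + \<epsilon>) \<le> (\<integral>(\<omega>, t). cost_rate c I \<omega> t + \<epsilon> * slope c I \<sigma> \<epsilon> \<omega> t \<partial>Q)"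
    by (rule v_le_integral[OF perturbed_in_controls[OF I \<sigma> \<epsilon>(1)]])
      (use integrable cost_rate_perturbed_le[OF I _ _ \<epsilon>(1)] in \<open>simp_all add: split_beta'\<close>)
  also have "\<dots> = v c + \<epsilon> * (\<integral>(\<omega>, t). slope c I \<sigma> \<epsilon> \<omega> t \<partial>Q)"
    using integrable v_eq_integral_cost_rate[OF I optimal] by (simp add: split_beta')
  finally show ?thesis .
qed

lemma upper_right_dini_v_le:
  assumes I: "I \<in> controls M F" and optimal: "optimal_cost c = cost c I" and \<sigma>: "stopping_time F \<sigma>"
  shows "upper_right_dini v c \<le> ereal (payoff c \<sigma> (purchase_time I))"
proof -
  let ?s = "\<lambda>\<epsilon>. \<integral>(\<omega>, t). slope c I \<sigma> \<epsilon> \<omega> t \<partial>Q"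
  have "\<forall>\<^sub>F \<epsilon> :: real in at_right 0. \<epsilon> < 1" by (rule order_tendstoD(2)[OF tendsto_ident_at]) simp
  with eventually_at_right_less[of "0 :: real"]
  have "\<forall>\<^sub>F \<epsilon> in at_right 0. ereal ((v (c + \<epsilon>) - v c) / \<epsilon>) \<le> ereal (?s \<epsilon>)"
  proof eventually_elim
    case (elim \<epsilon>)
    then show ?case
      using v_perturbed_le[OF I optimal \<sigma>, of \<epsilon>] by (simp add: divide_le_eq mult.commute)
  qed
  then have "upper_right_dini v c \<le> Limsup (at_right 0) (\<lambda>\<epsilon>. ereal (?s \<epsilon>))"
    unfolding upper_right_dini_def by (rule Limsup_mono)
  also have "\<dots> = ereal (\<integral>(\<omega>, t). slope_limit c I \<sigma> \<omega> t \<partial>Q)"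
    by (intro lim_imp_Limsup tendsto_ereal integral_slope_tendsto[OF I \<sigma>]) simp
  also have "\<dots> \<le> ereal (payoff c \<sigma> (purchase_time I))"
    using integral_slope_limit_le_payoff[OF I \<sigma>] by simp
  finally show ?thesis .
qed

subsection \<open>Reflection and the saddle point\<close>

lemma control_problem_reflected: "control_problem M F X U (\<lambda>c. g (- c)) (\<lambda>c d. - gc (- c) d) \<rho> qm qp"
proof unfold_locales
  show "convex_on UNIV (\<lambda>c. g (- c) d)" if "d \<in> U" for d
  proof (rule convex_onI)
    fix u x y :: real assume u: "0 < u" "u < 1"
    have "g ((1 - u) *\<^sub>R (- x) + u *\<^sub>R (- y)) d \<le> (1 - u) * g (- x) d + u * g (- y) d"
      by (rule convex_onD[OF g_convex[OF that]]) (use u in auto)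
    then show "g (- ((1 - u) *\<^sub>R x + u *\<^sub>R y)) d \<le> (1 - u) * g (- x) d + u * g (- y) d"
      by (simp add: algebra_simps)
  qed simp
  show "((\<lambda>x. g (- x) d) has_real_derivative - gc (- c) d) (at c)" if "d \<in> U" for c d
    using DERIV_chain2[OF g_deriv[OF that] DERIV_minus[OF DERIV_ident], of c] by simp
  have reflection: "continuous_on (UNIV \<times> U) (\<lambda>p :: real \<times> real. (- fst p, snd p))"
    by (intro continuous_intros)
  show "continuous_on (UNIV \<times> U) (\<lambda>(c, d). g (- c) d)"
    using continuous_on_compose2[OF g_cont reflection]
    by (simp add: split_beta' image_subset_iff mem_Times_iff)
  have "continuous_on (UNIV \<times> U) (\<lambda>p. gc (- fst p) (snd p))"
    using continuous_on_compose2[OF gc_cont reflection]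
    by (simp add: split_beta' image_subset_iff mem_Times_iff)
  then show "continuous_on (UNIV \<times> U) (\<lambda>(c, d). - gc (- c) d)"
    by (auto simp: split_beta' intro: continuous_on_minus)
  show "integrable Q (\<lambda>(\<omega>, t). - gc (- c) (X t \<omega>))" for c
    using Bochner_Integration.integrable_minus[OF gc_integrable[of "- c"]]
    by (simp add: split_beta')
qed (use F_right g_nonneg g_integrable \<rho>_pos qp_pos qm_pos in auto)

lemma cost_reflected:
  "total_cost M \<rho> qm qp (\<lambda>c. g (- c)) X (- c) (\<lambda>t \<omega>. - I t \<omega>) = cost c I"
  by (simp add: total_cost_def add.assoc add.commute[of "ennreal qm * _"] add.commute[of c])

lemma optimal_cost_reflected:
  "control_problem.optimal_cost M F X (\<lambda>c. g (- c)) \<rho> qm qp (- c) = optimal_cost c"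
proof -
  have "I \<in> (\<lambda>I t \<omega>. - I t \<omega>) ` controls M F" if "I \<in> controls M F" for I
    using controls_uminus[OF that] by (intro image_eqI[of _ _ "\<lambda>t \<omega>. - I t \<omega>"]) auto
  then have "controls M F = (\<lambda>I t \<omega>. - I t \<omega>) ` controls M F"
    using controls_uminus by auto
  then have "(INF I\<in>controls M F. total_cost M \<rho> qm qp (\<lambda>c. g (- c)) X (- c) I) =
      (INF I\<in>(\<lambda>I t \<omega>. - I t \<omega>) ` controls M F. total_cost M \<rho> qm qp (\<lambda>c. g (- c)) X (- c) I)"
    by (rule arg_cong[where f="\<lambda>A. Inf (_ ` A)"])
  then show ?thesis
    by (simp add: control_problem.optimal_cost_def[OF control_problem_reflected] optimal_cost_def
        image_image cost_reflected)
qed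

lemma payoff_reflected:
  "dynkin_payoff M \<rho> qm qp (\<lambda>c d. - gc (- c) d) X (- c) \<tau> \<sigma> = - payoff c \<sigma> \<tau>"
  unfolding dynkin_payoff_def Bochner_Integration.integral_minus[symmetric]
  by (intro Bochner_Integration.integral_cong refl)
    (simp add: min.commute set_lebesgue_integral_def)

lemma lower_left_dini_v_ge:
  assumes I: "I \<in> controls M F" and optimal: "optimal_cost c = cost c I" and \<tau>: "stopping_time F \<tau>"
  shows "ereal (payoff c (sale_time I) \<tau>) \<le> lower_left_dini v c"
proof -
  interpret R: control_problem M F X U "\<lambda>c. g (- c)" "\<lambda>c d. - gc (- c) d" \<rho> qm qp
    by (rule control_problem_reflected)
  have "R.optimal_cost (- c) = R.cost (- c) (\<lambda>t \<omega>. - I t \<omega>)"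
    unfolding optimal_cost_reflected cost_reflected by (rule optimal)
  from R.upper_right_dini_v_le[OF controls_uminus[OF I] this \<tau>]
  have "upper_right_dini R.v (- c) \<le> - ereal (payoff c (sale_time I) \<tau>)"
    by (simp add: purchase_time_uminus payoff_reflected)
  moreover have "R.v = (\<lambda>y. v (- y))"
    using optimal_cost_reflected[of "- _"] by (simp add: fun_eq_iff)
  ultimately show ?thesis
    unfolding lower_left_dini_mirror by (metis ereal_minus_le_minus ereal_uminus_uminus)
qed

theorem payoff_saddle_point:
  assumes I: "I \<in> controls M F" and optimal: "optimal_cost c = cost c I"
    and \<sigma>: "stopping_time F \<sigma>" and \<tau>: "stopping_time F \<tau>"
  shows "payoff c (sale_time I) \<tau> \<le> payoff c \<sigma> (purchase_time I)"
proof -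
  have "ereal (payoff c (sale_time I) \<tau>) \<le> lower_left_dini v c"
    by (rule lower_left_dini_v_ge[OF I optimal \<tau>])
  also have "\<dots> \<le> upper_right_dini v c"
    by (rule convex_on_lower_left_le_upper_right_dini[OF convex_on_v])
  also have "\<dots> \<le> ereal (payoff c \<sigma> (purchase_time I))"
    by (rule upper_right_dini_v_le[OF I optimal \<sigma>])
  finally show ?thesis by simp
qed

theorem v_has_real_derivative:
  assumes I: "I \<in> controls M F" and optimal: "optimal_cost c = cost c I"
  shows "(v has_real_derivative payoff c (sale_time I) (purchase_time I)) (at c)"
  using convex_on_v
    upper_right_dini_v_le[OF I optimal stopping_time_sale_time[OF I]]
    lower_left_dini_v_ge[OF I optimal stopping_time_purchase_time[OF I]]
  by (rule convex_on_has_real_derivative_dini)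

end

section \<open>The capacity problem\<close>

lemma open_open_interval: "open (open_interval l r)"
  unfolding open_interval_def by (intro open_Collect_conj open_Collect_less continuous_intros)

lemma abs_pow_nonneg: "0 \<le> abs_pow x \<nu>"
  by (simp add: abs_pow_def)

lemma borel_measurable_abs_pow [measurable]: "(\<lambda>x. abs_pow x \<nu>) \<in> borel_measurable borel"
  unfolding abs_pow_def by measurable

lemma dynkin_has_value_saddle_point:
  assumes "stopping_time F \<sigma>'" "stopping_time F \<tau>'"
    and saddle: "\<And>\<sigma> \<tau>. stopping_time F \<sigma> \<Longrightarrow> stopping_time F \<tau> \<Longrightarrow>
      dynkin_payoff M \<rho> qp qm gc (D d) c \<sigma>' \<tau> \<le> dynkin_payoff M \<rho> qp qm gc (D d) c \<sigma> \<tau>'"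
  shows "dynkin_has_value M F \<rho> qp qm gc D c d (dynkin_payoff M \<rho> qp qm gc (D d) c \<sigma>' \<tau>')"
  unfolding dynkin_has_value_def dynkin_lower_def dynkin_upper_def
  by (intro conjI
      saddle_point_value[where J="\<lambda>\<sigma> \<tau>. ereal (dynkin_payoff M \<rho> qp qm gc (D d) c \<sigma> \<tau>)"])
    (use assms in auto)

context capacity_setting
begin

lemma state_process_demand:
  "d \<in> open_interval dmin dmax \<Longrightarrow> state_process M F (D d) (open_interval dmin dmax)"
  using D_solution[of d] F_sub open_open_interval by unfold_locales (auto simp: sde_solution_def)

lemma integrable_abs_pow_demand:
  assumes d: "d \<in> open_interval dmin dmax"
  shows "integrable (M \<Otimes>\<^sub>M disc_lborel \<rho>) (\<lambda>(\<omega>, t). abs_pow (D d t \<omega>) \<nu>)"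
proof (rule integrableI_nonneg)
  interpret state_process M F "D d" "open_interval dmin dmax" by (rule state_process_demand[OF d])
  have \<rho>: "0 < \<rho>" "0 < \<rho> - K1" using rho by auto
  interpret L: finite_measure "disc_lborel \<rho>" by (rule finite_measure_disc_lborel[OF \<rho>(1)])
  interpret L': finite_measure "disc_lborel (\<rho> - K1)" by (rule finite_measure_disc_lborel[OF \<rho>(2)])
  interpret pair_sigma_finite M "disc_lborel \<rho>" ..
  let ?C = "K0 * (1 + abs_pow d \<nu>)"
  have C: "0 \<le> ?C" using K0_nonneg abs_pow_nonneg[of d \<nu>] by simp
  have "(\<integral>\<^sup>+p. ennreal (case p of (\<omega>, t) \<Rightarrow> abs_pow (D d t \<omega>) \<nu>) \<partial>(M \<Otimes>\<^sub>M disc_lborel \<rho>)) =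
      (\<integral>\<^sup>+t. (\<integral>\<^sup>+\<omega>. ennreal (abs_pow (D d t \<omega>) \<nu>) \<partial>M) \<partial>disc_lborel \<rho>)"
    by (subst nn_integral_snd[symmetric]) (simp_all add: split_beta')
  also have "\<dots> \<le> (\<integral>\<^sup>+t. ennreal ?C * ennreal (exp (K1 * t)) \<partial>disc_lborel \<rho>)"
    using D_moments[OF d] C by (intro nn_integral_mono) (simp add: ennreal_mult'[symmetric])
  also have "\<dots> = ennreal ?C * (\<integral>\<^sup>+t. ennreal (exp (K1 * t)) \<partial>disc_lborel \<rho>)"
    by (rule nn_integral_cmult) measurable
  also have "(\<integral>\<^sup>+t. ennreal (exp (K1 * t)) \<partial>disc_lborel \<rho>) = (\<integral>\<^sup>+t. 1 \<partial>disc_lborel (\<rho> - K1))"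
    by (subst (1 2) nn_integral_disc_lborel)
      (auto intro!: nn_integral_cong simp: indicator_def ennreal_mult'[symmetric]
        exp_add[symmetric] algebra_simps)
  also have "ennreal ?C * (\<integral>\<^sup>+t. 1 \<partial>disc_lborel (\<rho> - K1)) < \<infinity>"
    using L'.emeasure_finite[of "{0..}"] by (simp add: less_top[symmetric] ennreal_mult_eq_top_iff)
  finally show "(\<integral>\<^sup>+p. ennreal (case p of (\<omega>, t) \<Rightarrow> abs_pow (D d t \<omega>) \<nu>) \<partial>(M \<Otimes>\<^sub>M disc_lborel \<rho>)) < \<infinity>" .
  show "(\<lambda>(\<omega>, t). abs_pow (D d t \<omega>) \<nu>) \<in> borel_measurable (M \<Otimes>\<^sub>M disc_lborel \<rho>)"
    unfolding split_beta' by measurable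
qed (auto simp: abs_pow_nonneg)

lemma integrable_polynomial_growth:
  fixes h :: "real \<Rightarrow> real \<Rightarrow> real"
  assumes d: "d \<in> open_interval dmin dmax"
    and h: "continuous_on (UNIV \<times> open_interval dmin dmax) (\<lambda>(c, d). h c d)"
    and growth: "\<And>x. x \<in> open_interval dmin dmax \<Longrightarrow> \<bar>h c x\<bar> \<le> a + b * abs_pow x \<nu>"
  shows "integrable (M \<Otimes>\<^sub>M disc_lborel \<rho>) (\<lambda>(\<omega>, t). h c (D d t \<omega>))"
proof (rule Bochner_Integration.integrable_bound)
  interpret state_process M F "D d" "open_interval dmin dmax" by (rule state_process_demand[OF d])
  interpret L: finite_measure "disc_lborel \<rho>" by (rule finite_measure_disc_lborel) (use rho in simp)
  interpret pair_sigma_finite M "disc_lborel \<rho>" ..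
  interpret Q: finite_measure "M \<Otimes>\<^sub>M disc_lborel \<rho>"
    by (rule finite_measure_pair_measure) unfold_locales
  show "integrable (M \<Otimes>\<^sub>M disc_lborel \<rho>) (\<lambda>(\<omega>, t). a + b * abs_pow (D d t \<omega>) \<nu>)"
    using integrable_abs_pow_demand[OF d] by (simp add: split_beta')
  show "(\<lambda>(\<omega>, t). h c (D d t \<omega>)) \<in> borel_measurable (M \<Otimes>\<^sub>M disc_lborel \<rho>)"
    unfolding split_beta' by (rule borel_measurable_continuous_on_X[OF h]) simp
  show "AE p in M \<Otimes>\<^sub>M disc_lborel \<rho>. norm (case p of (\<omega>, t) \<Rightarrow> h c (D d t \<omega>))
      \<le> norm (case p of (\<omega>, t) \<Rightarrow> a + b * abs_pow (D d t \<omega>) \<nu>)"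
    using growth X_in
    by (intro AE_I2) (auto simp: space_pair_measure intro: order_trans[OF _ abs_ge_self])
qed

lemma control_problem_demand:
  assumes d: "d \<in> open_interval dmin dmax"
  shows "control_problem M F (D d) (open_interval dmin dmax) g gc \<rho> qp qm"
proof (intro control_problem.intro control_problem_axioms.intro state_process_demand[OF d])
  have growth: "\<bar>g c x\<bar> \<le> \<gamma>0 c + \<eta>0 c * abs_pow x \<nu>" "\<bar>gc c x\<bar> \<le> \<gamma>0 c + \<eta>0 c * abs_pow x \<nu>"
    if "x \<in> open_interval dmin dmax" for c x
    using g_growth[OF that, of c] by linarith+
  show "integrable (M \<Otimes>\<^sub>M disc_lborel \<rho>) (\<lambda>(\<omega>, t). g c (D d t \<omega>))" for c
    by (rule integrable_polynomial_growth[OF d g_cont growth(1)])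
  show "integrable (M \<Otimes>\<^sub>M disc_lborel \<rho>) (\<lambda>(\<omega>, t). gc c (D d t \<omega>))" for c
    by (rule integrable_polynomial_growth[OF d gc_cont growth(2)])
  show "sets (F t) = (\<Inter>u\<in>{t<..}. sets (F u))" if "t < \<infinity>" for t
    using usual that by (simp add: usual_conditions_def)
qed (use g_nonneg g_cont g_convex g_deriv gc_cont rho q_pos in auto)

theorem optimal_control_saddle_point:
  fixes I :: "real \<Rightarrow> 'a \<Rightarrow> real"
  defines "\<sigma>' \<equiv> sale_time I" and "\<tau>' \<equiv> purchase_time I"
  assumes d: "d \<in> open_interval dmin dmax" and I: "I \<in> controls M F"
    and optimal: "value_fun M F \<rho> qp qm g D c d = total_cost M \<rho> qp qm g (D d) c I"
  shows "value_fun M F \<rho> qp qm g D c d < \<infinity>"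
    and "stopping_time F \<sigma>'" and "stopping_time F \<tau>'"
    and "\<And>\<sigma> \<tau>. stopping_time F \<sigma> \<Longrightarrow> stopping_time F \<tau> \<Longrightarrow>
      dynkin_payoff M \<rho> qp qm gc (D d) c \<sigma>' \<tau> \<le> dynkin_payoff M \<rho> qp qm gc (D d) c \<sigma> \<tau>'"
    and "((\<lambda>x. enn2real (value_fun M F \<rho> qp qm g D x d)) has_real_derivative
      dynkin_payoff M \<rho> qp qm gc (D d) c \<sigma>' \<tau>') (at c)"
proof -
  interpret control_problem M F "D d" "open_interval dmin dmax" g gc \<rho> qp qm
    by (rule control_problem_demand[OF d])
  have value_fun: "value_fun M F \<rho> qp qm g D x d = optimal_cost x" for x
    by (simp add: optimal_cost_def value_fun_def)
  note optimal' = optimal[unfolded value_fun]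
  show "value_fun M F \<rho> qp qm g D c d < \<infinity>" unfolding value_fun by (rule optimal_cost_finite)
  show "stopping_time F \<sigma>'" "stopping_time F \<tau>'"
    unfolding \<sigma>'_def \<tau>'_def
    by (rule stopping_time_sale_time[OF I] stopping_time_purchase_time[OF I])+
  show "payoff c \<sigma>' \<tau> \<le> payoff c \<sigma> \<tau>'" if "stopping_time F \<sigma>" "stopping_time F \<tau>" for \<sigma> \<tau>
    unfolding \<sigma>'_def \<tau>'_def by (rule payoff_saddle_point[OF I optimal' that])
  show "((\<lambda>x. enn2real (value_fun M F \<rho> qp qm g D x d)) has_real_derivative payoff c \<sigma>' \<tau>') (at c)"
    unfolding value_fun \<sigma>'_def \<tau>'_def by (rule v_has_real_derivative[OF I optimal'])
qed

end

theorem proposition3p3: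
  fixes M :: "'a measure" and F :: "ennreal \<Rightarrow> 'a measure"
    and W :: "real \<Rightarrow> 'a \<Rightarrow> real" and dmin dmax :: ereal
    and \<mu> \<Sigma> :: "real \<Rightarrow> real" and D :: "real \<Rightarrow> real \<Rightarrow> 'a \<Rightarrow> real"
    and g gc :: "real \<Rightarrow> real \<Rightarrow> real" and \<gamma>0 \<eta>0 :: "real \<Rightarrow> real"
    and \<nu> K0 K1 \<rho> qp qm :: real
  assumes setting: "capacity_setting M F W dmin dmax \<mu> \<Sigma> D g gc \<gamma>0 \<eta>0 \<nu> K0 K1 \<rho> qp qm"
    and optimal_exists: "\<And>c d. d \<in> open_interval dmin dmax \<Longrightarrow>
          \<exists>I\<in>controls M F. total_cost M \<rho> qp qm g (D d) c I = value_fun M F \<rho> qp qm g D c d"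
  shows "(\<forall>c. \<forall>d\<in>open_interval dmin dmax. \<forall>I\<in>controls M F.
            value_fun M F \<rho> qp qm g D c d = total_cost M \<rho> qp qm g (D d) c I \<longrightarrow>
            (let \<sigma>' = (\<lambda>\<omega>. first_positive_time (neg_variation (\<lambda>t. I t \<omega>)));
                 \<tau>' = (\<lambda>\<omega>. first_positive_time (pos_variation (\<lambda>t. I t \<omega>)));
                 J = dynkin_payoff M \<rho> qp qm gc (D d) c
             in stopping_time F \<sigma>' \<and> stopping_time F \<tau>' \<and>
                (\<forall>\<sigma> \<tau>. stopping_time F \<sigma> \<longrightarrow> stopping_time F \<tau> \<longrightarrow>
                   J \<sigma>' \<tau> \<le> J \<sigma>' \<tau>' \<and> J \<sigma>' \<tau>' \<le> J \<sigma> \<tau>')))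
         \<and> (\<forall>c. \<forall>d\<in>open_interval dmin dmax.
              value_fun M F \<rho> qp qm g D c d < \<infinity> \<and>
              (\<exists>w. dynkin_has_value M F \<rho> qp qm gc D c d w \<and>
                   ((\<lambda>x. enn2real (value_fun M F \<rho> qp qm g D x d)) has_real_derivative w) (at c)))"
proof -
  interpret capacity_setting M F W dmin dmax \<mu> \<Sigma> D g gc \<gamma>0 \<eta>0 \<nu> K0 K1 \<rho> qp qm by (rule setting)
  have optimal_control:
    "\<exists>I\<in>controls M F. value_fun M F \<rho> qp qm g D c d = total_cost M \<rho> qp qm g (D d) c I"
    if "d \<in> open_interval dmin dmax" for c d
    using optimal_exists[OF that, of c] by metis
  show ?thesis
  proof (intro conjI allI ballI impI, goal_cases)
    case (1 c d I)
    from optimal_control_saddle_point[OF this] show ?case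
      by (simp add: Let_def sale_time_def[abs_def] purchase_time_def[abs_def])
  next
    case (2 c d)
    then show ?case using optimal_control optimal_control_saddle_point(1) by blast
  next
    case (3 c d)
    then obtain I where "I \<in> controls M F"
      "value_fun M F \<rho> qp qm g D c d = total_cost M \<rho> qp qm g (D d) c I"
      using optimal_control by blast
    note saddle = optimal_control_saddle_point[OF 3 this]
    then show ?case using dynkin_has_value_saddle_point[where D=D and d=d, OF saddle(2-4)] by blast
  qed
qed

end
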